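(* Let $f:\mathbb{R}^N\to\mathbb{R}\cup\{+\infty\}$ be a proper closed convex function, $A\in\mathbb{R}^{M\times N}$, $\bm{b}\in\mathbb{R}^M$, and let $\ell(\bm{y},\bm{x})=-\bm{b}^\top\bm{y}+\langle\bm{x},A^\top\bm{y}\rangle-f(\bm{x})$. Let $\rho\in[0,1)$, let $\{\sigma_k\}_{k\ge 0}$ be a positive sequence satisfying $\sigma_k\ge\sigma_{\min}>0$ for all $k\ge0$, and let $\{\tau_k\}_{k\ge0}$ be a positive sequence satisfying $$\tau_k\ge\tau_{\min}>0,\qquad \tau_{k+1}\le(1+\nu_k)\tau_k\quad\text{with}\quad \nu_k\ge0\ \text{ and }\ \sum_{k=0}^\infty\nu_k<+\infty .$$ Let $\{\bm{y}^k\}\subset\mathbb{R}^M$ and $\{\bm{x}^k\}\subset\mathbb{R}^N$ be sequences generated by the algorithm ripALM (described in the context) with these parameters, from arbitrary starting points $\bm{y}^0,\bm{w}^0\in\mathbb{R}^M$, $\bm{x}^0\in\mathbb{R}^N$. Suppose additionally that $\ell$ admits a saddle point (i.e., $(\partial\ell)^{-1}(\bm{0},\bm{0})\neq\emptyset$) and that the following error bound condition holds: for any $r>0$ there exists a constant $\kappa>0$ such that $$\mathrm{dist}\big((\bm{y},\bm{x}),(\partial\ell)^{-1}(\bm{0},\bm{0})\big)\le\kappa\,\mathrm{dist}\big((\bm{0},\bm{0}),\partial\ell(\bm{y},\bm{x})\big)$$ for all $(\bm{y},\bm{x})\in\mathbb{R}^M\times\mathbb{R}^N$ with $\mathrm{dist}((\bm{y},\bm{x}),(\partial\ell)^{-1}(\bm{0},\bm{0}))\le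 r$. Let $r>0$ be such that $\mathrm{dist}((\bm{y}^k,\bm{x}^k),(\partial\ell)^{-1}(\bm{0},\bm{0}))\le r$ for all $k\ge0$, and let $\kappa>0$ be a constant for which the error bound holds with this $r$. Suppose that $$\sqrt{\tau_{\min}}-2\sqrt{\rho}>0\quad\text{and}\quad\liminf_{k\to\infty}\ \sigma_k> c\cdot\frac{2\kappa\sqrt{\tau_{\max}}\left(\rho+\sqrt{\rho\,\overline{\tau}_{\max}}\right)}{\sqrt{\tau_{\min}}-2\sqrt{\rho}},$$ where $c>1$ is an arbitrarily given constant, $\tau_{\max}:=\tau_0\prod_{k=0}^\infty(1+\nu_k)$, and $\overline{\tau}_{\max}:=\max\{1,\tau_{\max}\}$. Let $\Lambda^k:=\mathrm{Diag}(\tau_kI_M,I_N)$, $\overline{\tau}_k:=\max\{1,\tau_k\}$ and $$\gamma_k:=\left(1-\frac{2\kappa\sqrt{\tau_k}\left(\rho+\sqrt{\rho\overline{\tau}_k}\right)+2\sigma_k\sqrt{\rho}}{\sigma_k\sqrt{\tau_k}}\right)\frac{\sigma_k^2}{\kappa^2\left(\sqrt{\rho}+\sqrt{\overline{\tau}_k}\right)^2\overline{\tau}_k}.$$ Then the following statements hold. (i) For all sufficiently large $k$, $$\gamma_k\ge\left(\frac{c-1}{c}\right)\cdot\frac{\sqrt{\tau_{\min}}-2\sqrt{\rho}}{\sqrt{\tau_{\min}}}\cdot\frac{\sigma_k^2}{\kappa^2\left(\sqrt{\rho}+\sqrt{\overline{\tau}_{\max}}\right)^2\overline{\tau}_{\max}}>0,$$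 and $$\mathrm{dist}_{\Lambda^{k+1}}\big((\bm{y}^{k+1},\bm{x}^{k+1}),(\partial\ell)^{-1}(\bm{0},\bm{0})\big)\le\mu_k\,\mathrm{dist}_{\Lambda^k}\big((\bm{y}^k,\bm{x}^k),(\partial\ell)^{-1}(\bm{0},\bm{0})\big),$$ where $\mu_k:=\sqrt{\dfrac{1+\nu_k}{1+\gamma_k}}$ satisfies $\limsup_{k\to\infty}\mu_k<1$ (as $\nu_k\to0$). (ii) The sequence $\{\bm{y}^k\}$ is convergent.
   Context: Notation. $\|\cdot\|$ is the Euclidean norm; for a symmetric positive definite matrix $H$, $\|\bm{z}\|_H:=\sqrt{\langle\bm{z},H\bm{z}\rangle}$ and $\mathrm{dist}_H(\bm{z},\mathcal{S}):=\inf_{\bm{s}\in\mathcal{S}}\|\bm{z}-\bm{s}\|_H$; $\mathrm{dist}$ without subscript is the Euclidean distance ($H$ the identity; the distance to the empty set is $+\infty$). $I_n$ is the $n\times n$ identity, and $\mathrm{Diag}(\tau_kI_M,I_N)$ is the block-diagonal matrix acting on $(\bm{y},\bm{x})\in\mathbb{R}^M\times\mathbb{R}^N$. For a proper closed convex $f$: $\partial f$ is the convex subdifferential, and for $\nu>0$, $\mathtt{prox}_{\nu f}(\bm{x}):=\arg\min_{\bm{z}}\{f(\bm{z})+\frac{1}{2\nu}\|\bm{z}-\bm{x}\|^2\}$ and $\mathtt{M}_{\nu f}(\bm{x}):=\min_{\bm{z}}\{f(\bm{z})+\frac{1}{2\nu}\|\bm{z}-\bm{x}\|^2\}$. Subgradient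 map of the Lagrangian $\ell$: $$\partial\ell(\bm{y},\bm{x})=\{A\bm{x}-\bm{b}\}\times\{\bm{v}-A^\top\bm{y}\mid\bm{v}\in\partial f(\bm{x})\}.$$ $(\partial\ell)^{-1}(\bm{0},\bm{0})$ is the set of $(\bm{y},\bm{x})$ with $(\bm{0},\bm{0})\in\partial\ell(\bm{y},\bm{x})$; its elements are called saddle points of $\ell$. Augmented Lagrangian. For $\sigma>0$, $$\mathcal{L}_\sigma(\bm{y},\bm{x}):=-\bm{b}^\top\bm{y}+\frac{1}{2\sigma}\|\bm{x}+\sigma A^\top\bm{y}\|^2-\frac{1}{2\sigma}\|\bm{x}\|^2-\mathtt{M}_{\sigma f}(\bm{x}+\sigma A^\top\bm{y}),$$ which is continuously differentiable in $\bm{y}$ with $\nabla_y\mathcal{L}_\sigma(\bm{y},\bm{x})=A\,\mathtt{prox}_{\sigma f}(\bm{x}+\sigma A^\top\bm{y})-\bm{b}$. Algorithm ripALM. Given $\rho\in[0,1)$, positive sequences $\{\sigma_k\},\{\tau_k\}$ and arbitrary $\bm{y}^0,\bm{w}^0\in\mathbb{R}^M$, $\bm{x}^0\in\mathbb{R}^N$, for $k=0,1,2,\dots$ (run indefinitely): Step 1. Approximately solve $\min_{\bm{y}}\ \mathcal{L}_{\sigma_k}(\bm{y},\bm{x}^k)+\frac{\tau_k}{2\sigma_k}\|\bm{y}-\bm{y}^k\|^2$, in the sense that $\bm{y}^{k+1}\in\mathbb{R}^M$ is any point such that, with $$\Delta^{k+1}:=\nabla_y\mathcal{L}_{\sigma_k}(\bm{y}^{k+1},\bm{x}^k)+\tau_k\sigma_k^{-1}(\bm{y}^{k+1}-\bm{y}^k),$$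 one has $$2\big|\langle\bm{w}^k-\bm{y}^{k+1},\sigma_k\Delta^{k+1}\rangle\big|+\|\sigma_k\Delta^{k+1}\|^2\le\rho\Big(\big\|\mathtt{prox}_{\sigma_k f}(\bm{x}^k+\sigma_kA^\top\bm{y}^{k+1})-\bm{x}^k\big\|^2+\tau_k\|\bm{y}^{k+1}-\bm{y}^k\|^2\Big).$$ Step 2. Set $\bm{x}^{k+1}=\mathtt{prox}_{\sigma_kf}(\bm{x}^k+\sigma_kA^\top\bm{y}^{k+1})$ and $\bm{w}^{k+1}=\bm{w}^k-\sigma_k\Delta^{k+1}$. Under the stated conditions on $\rho,\{\sigma_k\},\{\tau_k\}$ and existence of a saddle point, the sequences $\{\bm{y}^k\}$, $\{\bm{x}^k\}$ are bounded, so a number $r$ as in the claim exists. *)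

theory Defs
  imports "HOL-Analysis.Analysis"
begin

definition proper_fun :: "('a \<Rightarrow> ereal) \<Rightarrow> bool" where
  "proper_fun f \<longleftrightarrow> (\<exists>x. f x < \<infinity>) \<and> (\<forall>x. f x \<noteq> -\<infinity>)"

definition epi :: "('a \<Rightarrow> ereal) \<Rightarrow> ('a \<times> real) set" where
  "epi f = {(x, t). f x \<le> ereal t}"

definition proper_closed_convex :: "('a::euclidean_space \<Rightarrow> ereal) \<Rightarrow> bool" where
  "proper_closed_convex f \<longleftrightarrow> proper_fun f \<and> closed (epi f) \<and> convex (epi f)"

text \<open>
  For a proper \<open>f\<close> this set is empty at every point outside the effective domain, since then
  the left-hand side is \<open>\<infinity>\<close> while \<open>f z\<close> is finite for some \<open>z\<close>.
\<close>

definition subdifferential :: "('a::euclidean_space \<Rightarrow> ereal) \<Rightarrow> 'a \<Rightarrow> 'a set" where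
  "subdifferential f x = {v. \<forall>z. f x + ereal (v \<bullet> (z - x)) \<le> f z}"

text \<open>
  The argument order \<open>prox \<nu> f x\<close> and \<open>moreau \<nu> f x\<close> stands for the
  proximal mapping and the Moreau envelope of the product of \<open>\<nu> > 0\<close> and \<open>f\<close>.
  For a proper closed convex \<open>f\<close> the minimizer exists and is unique, so the choice made by
  \<open>arg_min\<close> is immaterial and the infimum is a finite minimum.
\<close>

definition prox :: "real \<Rightarrow> ('a::euclidean_space \<Rightarrow> ereal) \<Rightarrow> 'a \<Rightarrow> 'a" where
  "prox \<nu> f x = (ARG_MIN (\<lambda>z. f z + ereal (1 / (2 * \<nu>) * (norm (z - x))\<^sup>2)) z. True)"

definition moreau :: "real \<Rightarrow> ('a::euclidean_space \<Rightarrow> ereal) \<Rightarrow> 'a \<Rightarrow> ereal" where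
  "moreau \<nu> f x = (INF z. f z + ereal (1 / (2 * \<nu>) * (norm (z - x))\<^sup>2))"

definition gradient :: "('a::euclidean_space \<Rightarrow> real) \<Rightarrow> 'a \<Rightarrow> 'a" where
  "gradient g y = (THE D. GDERIV g y :> D)"

text \<open>
  Distances to a set take values in the extended reals, so that the distance to the empty set
  is \<open>\<infinity>\<close>; this rules out the library's \<open>infdist\<close> and \<open>setdist\<close>, which give 0 there.
  A weight \<open>H\<close> is a (symmetric positive definite) linear operator.
\<close>

definition dist_to :: "'a::metric_space \<Rightarrow> 'a set \<Rightarrow> ereal" where
  "dist_to z S = (INF s\<in>S. ereal (dist z s))"

definition wnorm :: "('a::euclidean_space \<Rightarrow> 'a) \<Rightarrow> 'a \<Rightarrow> real" where
  "wnorm H z = sqrt (z \<bullet> H z)"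

definition wdist_to :: "('a::euclidean_space \<Rightarrow> 'a) \<Rightarrow> 'a \<Rightarrow> 'a set \<Rightarrow> ereal" where
  "wdist_to H z S = (INF s\<in>S. ereal (wnorm H (z - s)))"

definition diag_op ::
    "real \<Rightarrow> (real ^ 'm) \<times> (real ^ 'n) \<Rightarrow> (real ^ 'm) \<times> (real ^ 'n)" where
  "diag_op t = (\<lambda>(y, x). (t *\<^sub>R y, x))"

definition lagrangian ::
    "real ^ 'n ^ 'm \<Rightarrow> real ^ 'm \<Rightarrow> (real ^ 'n \<Rightarrow> ereal) \<Rightarrow>
     (real ^ 'm) \<times> (real ^ 'n) \<Rightarrow> ereal" where
  "lagrangian A b f = (\<lambda>(y, x). ereal (- (b \<bullet> y) + x \<bullet> (transpose A *v y)) - f x)"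

definition lagrangian_subgrad ::
    "real ^ 'n ^ 'm \<Rightarrow> real ^ 'm \<Rightarrow> (real ^ 'n \<Rightarrow> ereal) \<Rightarrow>
     (real ^ 'm) \<times> (real ^ 'n) \<Rightarrow> ((real ^ 'm) \<times> (real ^ 'n)) set" where
  "lagrangian_subgrad A b f =
     (\<lambda>(y, x). {A *v x - b} \<times> {v - transpose A *v y | v. v \<in> subdifferential f x})"

text \<open>
  The second factor is the subdifferential of the negative of the Lagrangian, which is convex
  in the primal variable; the first one is its gradient in the dual variable.
\<close>

lemma lagrangian_subgrad_snd:
  "{v - transpose A *v y | v. v \<in> subdifferential f x}
     = subdifferential (\<lambda>x'. - lagrangian A b f (y, x')) x"
proof -
  have key: "v \<in> subdifferential f x \<longleftrightarrow>
      v - transpose A *v y \<in> subdifferential (\<lambda>x'. - lagrangian A b f (y, x')) x" for v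
  proof -
    have "(f x + ereal (v \<bullet> (z - x)) \<le> f z) \<longleftrightarrow>
      (- lagrangian A b f (y, x) + ereal ((v - transpose A *v y) \<bullet> (z - x))
        \<le> - lagrangian A b f (y, z))" for z
      by (cases "f x"; cases "f z")
         (auto simp: lagrangian_def inner_diff_left inner_diff_right inner_commute)
    then show ?thesis
      by (simp add: subdifferential_def)
  qed
  show ?thesis
  proof (intro set_eqI iffI)
    fix u assume "u \<in> subdifferential (\<lambda>x'. - lagrangian A b f (y, x')) x"
    then have "u + transpose A *v y \<in> subdifferential f x"
      using key[of "u + transpose A *v y"] by simp
    then show "u \<in> {v - transpose A *v y | v. v \<in> subdifferential f x}"
      by (metis (mono_tags, lifting) add_diff_cancel_right' mem_Collect_eq)
  qed (use key in auto)
qed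

lemma lagrangian_subgrad_fst:
  assumes "\<bar>f x\<bar> \<noteq> \<infinity>"
  shows "GDERIV (\<lambda>y'. real_of_ereal (lagrangian A b f (y', x))) y :> A *v x - b"
proof -
  obtain c where c: "f x = ereal c"
    using assms by (cases "f x") auto
  have "x \<bullet> (transpose A *v y') = y' \<bullet> (A *v x)" for y'
    by (metis dot_lmul_matrix inner_commute transpose_matrix_vector)
  then have "(\<lambda>y'. real_of_ereal (lagrangian A b f (y', x))) = (\<lambda>y'. y' \<bullet> (A *v x - b) - c)"
    by (auto simp: lagrangian_def c inner_diff_right inner_commute)
  then show ?thesis
    by (auto simp: gderiv_def intro!: derivative_eq_intros)
qed

definition saddle_points ::
    "real ^ 'n ^ 'm \<Rightarrow> real ^ 'm \<Rightarrow> (real ^ 'n \<Rightarrow> ereal) \<Rightarrow> ((real ^ 'm) \<times> (real ^ 'n)) set" where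
  "saddle_points A b f = {z. (0, 0) \<in> lagrangian_subgrad A b f z}"

definition error_bound ::
    "real ^ 'n ^ 'm \<Rightarrow> real ^ 'm \<Rightarrow> (real ^ 'n \<Rightarrow> ereal) \<Rightarrow> real \<Rightarrow> real \<Rightarrow> bool" where
  "error_bound A b f r \<kappa> \<longleftrightarrow>
     (\<forall>z. dist_to z (saddle_points A b f) \<le> ereal r \<longrightarrow>
        dist_to z (saddle_points A b f) \<le> ereal \<kappa> * dist_to (0, 0) (lagrangian_subgrad A b f z))"

definition aug_lagrangian ::
    "real ^ 'n ^ 'm \<Rightarrow> real ^ 'm \<Rightarrow> (real ^ 'n \<Rightarrow> ereal) \<Rightarrow> real \<Rightarrow> real ^ 'm \<Rightarrow> real ^ 'n \<Rightarrow> real" where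
  "aug_lagrangian A b f \<sigma> y x =
     - (b \<bullet> y) + 1 / (2 * \<sigma>) * (norm (x + \<sigma> *\<^sub>R (transpose A *v y)))\<^sup>2
       - 1 / (2 * \<sigma>) * (norm x)\<^sup>2
       - real_of_ereal (moreau \<sigma> f (x + \<sigma> *\<^sub>R (transpose A *v y)))"

text \<open>
  \<open>ripALM_residual A b f \<sigma> \<tau> y x y'\<close> is the residual at the trial point \<open>y'\<close> of
  the subproblem posed at the iterate \<open>(y, x)\<close>; it is the gradient of that subproblem's
  objective function.
\<close>

definition ripALM_residual ::
    "real ^ 'n ^ 'm \<Rightarrow> real ^ 'm \<Rightarrow> (real ^ 'n \<Rightarrow> ereal) \<Rightarrow> real \<Rightarrow> real \<Rightarrow>
     real ^ 'm \<Rightarrow> real ^ 'n \<Rightarrow> real ^ 'm \<Rightarrow> real ^ 'm" where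
  "ripALM_residual A b f \<sigma> \<tau> y x y' =
     gradient (\<lambda>\<eta>. aug_lagrangian A b f \<sigma> \<eta> x) y' + (\<tau> / \<sigma>) *\<^sub>R (y' - y)"

text \<open>
  Since the inexactness criterion may admit many points, ``generated by ripALM'' is a relation on
  the sequences; the starting points are unrestricted.
\<close>

definition ripALM ::
    "real ^ 'n ^ 'm \<Rightarrow> real ^ 'm \<Rightarrow> (real ^ 'n \<Rightarrow> ereal) \<Rightarrow> real \<Rightarrow> (nat \<Rightarrow> real) \<Rightarrow> (nat \<Rightarrow> real) \<Rightarrow>
     (nat \<Rightarrow> real ^ 'm) \<Rightarrow> (nat \<Rightarrow> real ^ 'n) \<Rightarrow> (nat \<Rightarrow> real ^ 'm) \<Rightarrow> bool" where
  "ripALM A b f \<rho> \<sigma> \<tau> y x w \<longleftrightarrow>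
     (\<forall>k. let \<Delta> = ripALM_residual A b f (\<sigma> k) (\<tau> k) (y k) (x k) (y (Suc k));
              p = prox (\<sigma> k) f (x k + \<sigma> k *\<^sub>R (transpose A *v y (Suc k)))
          in 2 * \<bar>(w k - y (Suc k)) \<bullet> (\<sigma> k *\<^sub>R \<Delta>)\<bar> + (norm (\<sigma> k *\<^sub>R \<Delta>))\<^sup>2
               \<le> \<rho> * ((norm (p - x k))\<^sup>2 + \<tau> k * (norm (y (Suc k) - y k))\<^sup>2)
             \<and> x (Suc k) = p
             \<and> w (Suc k) = w k - \<sigma> k *\<^sub>R \<Delta>)"

end

theory Submission
  imports Defs
begin

text \<open>
  Write \<open>z = (y, x)\<close> and \<open>z' = (y', x')\<close> for consecutive iterates and \<open>D\<close> for the length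
  of \<open>z' - z\<close> in the norm weighted by \<open>\<tau>\<close>. The optimality condition of the proximal mapping
  and the gradient formula for the augmented Lagrangian turn one iteration into the inclusion
  \<open>(\<Delta> + (\<tau> / \<sigma>) (y - y'), (x - x') / \<sigma>) \<in> \<partial>\<ell> z'\<close> with \<open>norm (\<sigma> \<Delta>) \<le> sqrt \<rho> * D\<close>,
  that is, an inexact proximal point step for the monotone operator \<open>\<partial>\<ell>\<close>. Two estimates follow.

  Monotonicity gives, for every saddle point \<open>s\<close>, a Fejer inequality perturbed by the error term
  \<open>2 \<langle>y' - s\<^sub>y, \<sigma> \<Delta>\<rangle>\<close> (\<open>perturbed_fejer\<close>). The error bound, applied at \<open>z'\<close> with the above
  subgradient, gives \<open>dist (z', \<Omega>) \<le> a * D\<close> with \<open>a = \<kappa> (sqrt \<rho> + sqrt (max 1 \<tau>)) / \<sigma>\<close>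
  (\<open>error_le\<close>).

  What ties them together is that the set \<open>\<Omega>\<close> of saddle points is a product of a dual and a
  primal solution set (\<open>saddle_points_exchange\<close>). Hence the dual component of a
  projection onto \<open>\<Omega>\<close> is the Euclidean projection onto the dual solutions, whatever the weight,
  and in the Fejer inequality one may take for \<open>s\<^sub>y\<close> the projection of \<open>y\<close>. By nonexpansiveness
  \<open>y'\<close> is within \<open>(a + 1 / sqrt \<tau>) * D\<close> of this point, so the error term is at most
  \<open>2 sqrt \<rho> (a + 1 / sqrt \<tau>) * D\<^sup>2\<close>, and the squared weighted distance to \<open>\<Omega>\<close> drops by
  \<open>\<theta> * D\<^sup>2\<close> with \<open>\<theta> = 1 - 2 sqrt \<rho> (a + 1 / sqrt \<tau>)\<close> (\<open>sufficient_decrease\<close>). Bounding \<open>D\<close>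
  from below by the error bound turns this into the factor \<open>1 / sqrt (1 + \<gamma>)\<close> (\<open>contraction\<close>), and
  changing the weight costs \<open>sqrt (1 + \<nu>)\<close>. The lower bound on the penalty parameters keeps \<open>\<theta>\<close>
  above a positive constant (\<open>decrease_factor_lower_bound\<close>). As \<open>sqrt \<theta> * D\<close> is also at most the
  distance of \<open>z\<close> to \<open>\<Omega>\<close> (\<open>step_length_le_dist\<close>), the dual increments decay geometrically,
  which makes the dual sequence Cauchy.
\<close>

section \<open>The proximal mapping\<close>

text \<open>
  Separate the epigraph from a point strictly below it over the effective domain. The
  separating hyperplane cannot be vertical, because the epigraph contains a point
  directly above the separated one.
\<close>

lemma proper_closed_convex_affine_minorant:
  assumes "proper_closed_convex f"
  obtains a \<beta> where "\<And>z. ereal (a \<bullet> z + \<beta>) \<le> f z"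
proof -
  from assms obtain x0 where "f x0 < \<infinity>" and ninf: "\<And>z. f z \<noteq> -\<infinity>"
    by (auto simp: proper_closed_convex_def proper_fun_def)
  then obtain t0 where t0: "f x0 = ereal t0" by (cases "f x0") auto
  have "(x0, t0 - 1) \<notin> epi f" by (simp add: epi_def t0)
  then obtain n e where below: "n \<bullet> (x0, t0 - 1) < e" and above: "\<And>u. u \<in> epi f \<Longrightarrow> e < n \<bullet> u"
    using separating_hyperplane_closed_point[of "epi f" "(x0, t0 - 1)"] assms
    unfolding proper_closed_convex_def by blast
  obtain p q where n: "n = (p, q)" by (cases n)
  have "(x0, t0) \<in> epi f" by (simp add: epi_def t0)
  from below above[OF this] have q: "q > 0"
    by (simp add: n algebra_simps)
  show thesis
  proof (rule that)
    fix z
    show "ereal (((- 1 / q) *\<^sub>R p) \<bullet> z + e / q) \<le> f z"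
    proof (cases "f z")
      case (real t)
      then have "e < p \<bullet> z + q * t"
        using above[of "(z, t)"] by (simp add: epi_def n)
      then show ?thesis using q real by (simp add: field_simps)
    qed (use ninf in auto)
  qed
qed

text \<open>
  Minimize the continuous function \<open>(z, t) \<mapsto> t + norm (z - x)\<^sup>2 / (2 \<nu>)\<close> over the closed
  epigraph. Along a sublevel set the affine minorant bounds \<open>t\<close> from below linearly, so the
  quadratic term bounds \<open>z\<close> and then \<open>t\<close>: the sublevel set is compact.
\<close>

lemma prox_objective_attained:
  assumes "proper_closed_convex f" and "\<nu> > 0"
  shows "\<exists>p. \<forall>z. f p + ereal (1 / (2 * \<nu>) * (norm (p - x))\<^sup>2)
                 \<le> f z + ereal (1 / (2 * \<nu>) * (norm (z - x))\<^sup>2)"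
proof -
  define h where "h = (\<lambda>u :: 'a \<times> real. snd u + 1 / (2 * \<nu>) * (norm (fst u - x))\<^sup>2)"
  from assms obtain x0 where "f x0 < \<infinity>" and ninf: "\<And>z. f z \<noteq> -\<infinity>"
    by (auto simp: proper_closed_convex_def proper_fun_def)
  then obtain t0 where t0: "f x0 = ereal t0" by (cases "f x0") auto
  obtain a \<beta> where minor: "\<And>z. ereal (a \<bullet> z + \<beta>) \<le> f z"
    using proper_closed_convex_affine_minorant[OF assms(1)] by blast
  define H where "H = h (x0, t0)"
  define S where "S = epi f \<inter> {u. h u \<le> H}"
  define B where "B = \<bar>H - a \<bullet> x - \<beta>\<bar>"
  \<comment> \<open>beyond the radius \<open>R \<ge> 1\<close> the quadratic term dominates the affine minorant\<close>
  define R where "R = 2 * \<nu> * (norm a + B + 1) + 1"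
  have R: "R \<ge> 1" using assms(2) by (simp add: R_def B_def)
  have cont: "continuous_on X h" for X
    unfolding h_def by (intro continuous_intros)
  have closed_S: "closed S"
    unfolding S_def
    by (intro closed_Int closed_Collect_le cont continuous_on_const)
      (use assms(1) in \<open>auto simp: proper_closed_convex_def\<close>)
  have bounds: "norm (z - x) \<le> R \<and> \<bar>t\<bar> \<le> norm a * (R + norm x) + \<bar>\<beta>\<bar> + \<bar>H\<bar>" if "(z, t) \<in> S" for z t
  proof -
    have "f z \<le> ereal t" using that by (simp add: S_def epi_def)
    then have "ereal (a \<bullet> z + \<beta>) \<le> ereal t" by (rule order_trans[OF minor])
    then have t: "a \<bullet> z + \<beta> \<le> t" by simp
    have hz: "t + 1 / (2 * \<nu>) * (norm (z - x))\<^sup>2 \<le> H"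
      using that by (simp add: S_def h_def)
    let ?d = "norm (z - x)"
    have "a \<bullet> (z - x) \<ge> - (norm a * ?d)"
      using Cauchy_Schwarz_ineq2[of a "z - x"] by linarith
    then have "1 / (2 * \<nu>) * ?d\<^sup>2 \<le> norm a * ?d + B"
      using t hz by (simp add: B_def inner_diff_right)
    then have d2: "?d\<^sup>2 \<le> 2 * \<nu> * (norm a * ?d + B)"
      using assms(2) by (simp add: field_simps)
    have dR: "?d \<le> R"
    proof (rule ccontr)
      assume "\<not> ?d \<le> R"
      then have d: "?d > R" "?d \<ge> 1" using R by auto
      have "B \<le> B * ?d" using d(2) by (simp add: B_def mult_le_cancel_left1)
      then have "norm a * ?d + B \<le> (norm a + B) * ?d" by (simp add: distrib_right)
      then have "2 * \<nu> * (norm a * ?d + B) \<le> 2 * \<nu> * ((norm a + B) * ?d)"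
        using assms(2) by (intro mult_left_mono) auto
      also have "\<dots> \<le> R * ?d"
      proof -
        have "2 * \<nu> * (norm a + B) \<le> R" using assms(2) by (simp add: R_def algebra_simps)
        then have "2 * \<nu> * (norm a + B) * ?d \<le> R * ?d"
          by (rule mult_right_mono) simp
        then show ?thesis by (simp add: mult.assoc)
      qed
      also have "\<dots> < ?d * ?d"
        using d by (intro mult_strict_right_mono) auto
      finally show False using d2 by (simp add: power2_eq_square)
    qed
    have "norm z \<le> R + norm x" using dR norm_triangle_sub[of z x] by simp
    then have "\<bar>a \<bullet> z\<bar> \<le> norm a * (R + norm x)"
      using Cauchy_Schwarz_ineq2[of a z] mult_left_mono[of "norm z" "R + norm x" "norm a"]
      by simp
    moreover have "t \<le> H"
    proof -
      have "0 \<le> 1 / (2 * \<nu>) * ?d\<^sup>2" using assms(2) by simp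
      with hz show ?thesis by linarith
    qed
    ultimately show ?thesis using dR t by linarith
  qed
  have "bounded S"
  proof (rule bounded_subset)
    show "bounded (cball x R \<times> cball 0 (norm a * (R + norm x) + \<bar>\<beta>\<bar> + \<bar>H\<bar>))"
      by (intro bounded_Times bounded_cball)
    show "S \<subseteq> cball x R \<times> cball 0 (norm a * (R + norm x) + \<bar>\<beta>\<bar> + \<bar>H\<bar>)"
      using bounds by (auto simp: dist_norm norm_minus_commute)
  qed
  then have "compact S" using closed_S by (simp add: compact_eq_bounded_closed)
  moreover have "(x0, t0) \<in> S" by (simp add: S_def epi_def t0 H_def)
  ultimately obtain u where u: "u \<in> S" and umin: "\<And>u'. u' \<in> S \<Longrightarrow> h u \<le> h u'"
    using continuous_attains_inf[of S h] cont by blast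
  obtain p t where pt: "u = (p, t)" by (cases u)
  have epi_min: "h u \<le> h u'" if "u' \<in> epi f" for u'
    using umin[of u'] u that by (cases "h u' \<le> H") (auto simp: S_def)
  show ?thesis
  proof (intro exI allI)
    fix z
    have fp: "f p \<le> ereal t" using u by (simp add: S_def epi_def pt)
    show "f p + ereal (1 / (2 * \<nu>) * (norm (p - x))\<^sup>2) \<le> f z + ereal (1 / (2 * \<nu>) * (norm (z - x))\<^sup>2)"
    proof (cases "f z")
      case (real s)
      have "f p + ereal (1 / (2 * \<nu>) * (norm (p - x))\<^sup>2)
              \<le> ereal t + ereal (1 / (2 * \<nu>) * (norm (p - x))\<^sup>2)"
        using fp by (rule add_right_mono)
      also have "\<dots> \<le> f z + ereal (1 / (2 * \<nu>) * (norm (z - x))\<^sup>2)"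
        using epi_min[of "(z, s)"] by (simp add: epi_def real h_def pt)
      finally show ?thesis .
    qed (use ninf in auto)
  qed
qed

lemma prox_minimizes:
  assumes "proper_closed_convex f" and "\<nu> > 0"
  shows "f (prox \<nu> f x) + ereal (1 / (2 * \<nu>) * (norm (prox \<nu> f x - x))\<^sup>2)
           \<le> f z + ereal (1 / (2 * \<nu>) * (norm (z - x))\<^sup>2)"
proof -
  obtain p where p: "\<And>z. f p + ereal (1 / (2 * \<nu>) * (norm (p - x))\<^sup>2)
                          \<le> f z + ereal (1 / (2 * \<nu>) * (norm (z - x))\<^sup>2)"
    using prox_objective_attained[OF assms] by blast
  show ?thesis
    unfolding prox_def
    by (rule arg_minI[where x = p]) (use p in \<open>auto simp: not_less\<close>)
qed

lemma prox_finite: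
  assumes "proper_closed_convex f" and "\<nu> > 0"
  obtains t where "f (prox \<nu> f x) = ereal t"
proof -
  from assms obtain x0 where "f x0 < \<infinity>" and ninf: "\<And>z. f z \<noteq> -\<infinity>"
    by (auto simp: proper_closed_convex_def proper_fun_def)
  then show thesis
    using prox_minimizes[OF assms, of x x0] that
    by (cases "f (prox \<nu> f x)"; cases "f x0") auto
qed

lemma moreau_eq:
  assumes "proper_closed_convex f" and "\<nu> > 0"
  shows "moreau \<nu> f x = f (prox \<nu> f x) + ereal (1 / (2 * \<nu>) * (norm (prox \<nu> f x - x))\<^sup>2)"
  unfolding moreau_def
  by (intro antisym INF_lower INF_greatest prox_minimizes[OF assms] UNIV_I)

text \<open>
  Fermat's rule without a subdifferential calculus: compare the minimizer \<open>p\<close> with the points of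
  the segment from \<open>p\<close> to \<open>z\<close>, divide by the step \<open>\<epsilon>\<close> along it, and let \<open>\<epsilon>\<close> tend to zero.
\<close>

lemma prox_subgradient:
  assumes pcc: "proper_closed_convex f" and "\<nu> > 0"
  shows "(1 / \<nu>) *\<^sub>R (x - prox \<nu> f x) \<in> subdifferential f (prox \<nu> f x)"
proof -
  define p where "p = prox \<nu> f x"
  obtain t where t: "f p = ereal t" using prox_finite[OF assms] p_def by blast
  have ninf: "\<And>z. f z \<noteq> -\<infinity>" using pcc by (auto simp: proper_closed_convex_def proper_fun_def)
  have "f p + ereal (((1 / \<nu>) *\<^sub>R (x - p)) \<bullet> (z - p)) \<le> f z" for z
  proof (cases "f z")
    case (real s)
    define L where "L = t - s + (x - p) \<bullet> (z - p) / \<nu>"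
    define K where "K = (norm (z - p))\<^sup>2 / (2 * \<nu>)"
    have K: "K \<ge> 0" using \<open>\<nu> > 0\<close> by (simp add: K_def)
    have LK: "L \<le> \<epsilon> * K" if l: "0 < \<epsilon>" "\<epsilon> \<le> 1" for \<epsilon>
    proof -
      let ?q = "(1 - \<epsilon>) *\<^sub>R p + \<epsilon> *\<^sub>R z"
      have "(1 - \<epsilon>) *\<^sub>R (p, t) + \<epsilon> *\<^sub>R (z, s) \<in> epi f"
        by (rule convexD_alt) (use pcc t real l in \<open>auto simp: proper_closed_convex_def epi_def\<close>)
      then have "f ?q \<le> ereal ((1 - \<epsilon>) * t + \<epsilon> * s)" by (simp add: epi_def)
      then have "f p + ereal (1 / (2 * \<nu>) * (norm (p - x))\<^sup>2)
          \<le> ereal ((1 - \<epsilon>) * t + \<epsilon> * s) + ereal (1 / (2 * \<nu>) * (norm (?q - x))\<^sup>2)"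
        using prox_minimizes[OF assms, of x ?q] p_def add_right_mono order_trans by blast
      then have "t + 1 / (2 * \<nu>) * (norm (p - x))\<^sup>2
          \<le> (1 - \<epsilon>) * t + \<epsilon> * s + 1 / (2 * \<nu>) * (norm (?q - x))\<^sup>2"
        by (simp add: t)
      moreover have expand: "(norm (?q - x))\<^sup>2
          = (norm (p - x))\<^sup>2 - 2 * \<epsilon> * ((x - p) \<bullet> (z - p)) + \<epsilon>\<^sup>2 * (norm (z - p))\<^sup>2"
      proof -
        have "?q - x = (p - x) + \<epsilon> *\<^sub>R (z - p)" by (simp add: algebra_simps)
        then show ?thesis
          by (simp only: power2_norm_eq_inner)
            (simp add: inner_add inner_diff inner_commute power2_eq_square algebra_simps)
      qed
      have "1 / (2 * \<nu>) * (norm (?q - x))\<^sup>2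
          = 1 / (2 * \<nu>) * (norm (p - x))\<^sup>2 - \<epsilon> * ((x - p) \<bullet> (z - p) / \<nu>) + \<epsilon> * (\<epsilon> * K)"
        unfolding expand K_def using \<open>\<nu> > 0\<close> by (simp add: field_simps power2_eq_square)
      ultimately have "\<epsilon> * L \<le> \<epsilon> * (\<epsilon> * K)"
        by (simp add: L_def algebra_simps)
      then show ?thesis using l by simp
    qed
    have "L \<le> 0"
    proof (rule ccontr)
      assume "\<not> L \<le> 0"
      then have "L > 0" by simp
      \<comment> \<open>the choice \<open>\<epsilon> = L / (L + K)\<close> keeps \<open>\<epsilon>\<close> in the unit interval and makes \<open>\<epsilon> * K\<close> less than \<open>L\<close>\<close>
      then have "L \<le> L / (L + K) * K" using K by (intro LK) auto
      then have "L * L \<le> 0" using \<open>L > 0\<close> K by (simp add: field_simps)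
      then show False using \<open>L > 0\<close> by (simp add: mult_le_0_iff)
    qed
    then show ?thesis using real t by (simp add: L_def)
  qed (use ninf in auto)
  then show ?thesis by (simp add: subdifferential_def p_def)
qed

lemma subdifferential_finite:
  assumes "proper_fun f" and "v \<in> subdifferential f x"
  obtains t where "f x = ereal t"
proof -
  from assms(1) obtain x0 where "f x0 < \<infinity>" and "f x \<noteq> -\<infinity>"
    by (auto simp: proper_fun_def)
  moreover have "f x + ereal (v \<bullet> (x0 - x)) \<le> f x0"
    using assms(2) by (simp add: subdifferential_def)
  ultimately show thesis using that by (cases "f x") auto
qed

lemma subdifferential_monotone:
  assumes "proper_fun f" and u: "u \<in> subdifferential f x" and v: "v \<in> subdifferential f y"
  shows "0 \<le> (u - v) \<bullet> (x - y)"
proof -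
  obtain s where s: "f x = ereal s" using subdifferential_finite[OF assms(1) u] .
  obtain t where t: "f y = ereal t" using subdifferential_finite[OF assms(1) v] .
  have "f x + ereal (u \<bullet> (y - x)) \<le> f y" "f y + ereal (v \<bullet> (x - y)) \<le> f x"
    using u v by (auto simp: subdifferential_def)
  then show ?thesis by (simp add: s t inner_diff inner_commute)
qed

lemma prox_nonexpansive:
  assumes pcc: "proper_closed_convex f" and "\<nu> > 0"
  shows "norm (prox \<nu> f u - prox \<nu> f v) \<le> norm (u - v)"
proof -
  let ?p = "prox \<nu> f u" and ?q = "prox \<nu> f v"
  have "0 \<le> ((1 / \<nu>) *\<^sub>R (u - ?p) - (1 / \<nu>) *\<^sub>R (v - ?q)) \<bullet> (?p - ?q)"
    by (rule subdifferential_monotone[of f])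
      (use pcc prox_subgradient[OF assms] in \<open>auto simp: proper_closed_convex_def\<close>)
  also have "\<dots> = (1 / \<nu>) * ((u - v) \<bullet> (?p - ?q) - (norm (?p - ?q))\<^sup>2)"
    by (simp add: power2_norm_eq_inner inner_diff_left algebra_simps)
  finally have "(norm (?p - ?q))\<^sup>2 \<le> (u - v) \<bullet> (?p - ?q)"
    using \<open>\<nu> > 0\<close> by (simp add: zero_le_divide_iff)
  also have "\<dots> \<le> norm (u - v) * norm (?p - ?q)" by (rule norm_cauchy_schwarz)
  finally have "norm (?p - ?q) * norm (?p - ?q) \<le> norm (u - v) * norm (?p - ?q)"
    by (simp add: power2_eq_square)
  then show ?thesis
    by (metis mult_right_le_imp_le norm_ge_zero order_less_le)
qed

section \<open>The gradient of the augmented Lagrangian\<close>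

text \<open>
  This is the Fenchel conjugate of \<open>z \<mapsto> f z + norm z\<^sup>2 / (2 \<nu>)\<close> at \<open>u / \<nu>\<close>, hence convex in \<open>u\<close>.
  Evaluated at \<open>x + \<sigma> A\<^sup>T y\<close> it equals the augmented Lagrangian up to a term affine in \<open>y\<close>.
\<close>

definition moreau_complement :: "real \<Rightarrow> ('a::euclidean_space \<Rightarrow> ereal) \<Rightarrow> 'a \<Rightarrow> real" where
  "moreau_complement \<nu> f u = 1 / (2 * \<nu>) * (norm u)\<^sup>2 - real_of_ereal (moreau \<nu> f u)"

text \<open>
  The proximal point of \<open>u\<close> is a competitor in the minimization that defines the envelope at \<open>v\<close>.
\<close>

lemma moreau_complement_subgradient:
  assumes "proper_closed_convex f" and "\<nu> > 0"
  shows "moreau_complement \<nu> f u + prox \<nu> f u \<bullet> (v - u) / \<nu> \<le> moreau_complement \<nu> f v"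
proof -
  let ?p = "prox \<nu> f u" and ?q = "prox \<nu> f v"
  obtain s where s: "f ?p = ereal s" using prox_finite[OF assms] .
  obtain t where t: "f ?q = ereal t" using prox_finite[OF assms] .
  have "t + 1 / (2 * \<nu>) * (norm (?q - v))\<^sup>2 \<le> s + 1 / (2 * \<nu>) * (norm (?p - v))\<^sup>2"
    using prox_minimizes[OF assms, of v ?p] by (simp add: s t)
  moreover have shift: "(norm (?p - v))\<^sup>2
      = (norm v)\<^sup>2 + (norm (?p - u))\<^sup>2 - (norm u)\<^sup>2 - 2 * (?p \<bullet> (v - u))"
    by (simp add: power2_norm_eq_inner inner_diff inner_commute)
  have "1 / (2 * \<nu>) * (norm (?p - v))\<^sup>2 - 1 / (2 * \<nu>) * (norm v)\<^sup>2
      = 1 / (2 * \<nu>) * (norm (?p - u))\<^sup>2 - 1 / (2 * \<nu>) * (norm u)\<^sup>2 - ?p \<bullet> (v - u) / \<nu>"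
    unfolding shift using \<open>\<nu> > 0\<close> by (simp add: field_simps)
  ultimately show ?thesis
    by (simp add: moreau_complement_def moreau_eq[OF assms] s t)
qed

text \<open>
  The subgradient inequalities at \<open>u\<close> and at \<open>v\<close> enclose the linearization error between \<open>0\<close> and
  \<open>\<langle>prox v - prox u, v - u\<rangle> / \<nu>\<close>, which is quadratically small since the proximal mapping is
  nonexpansive.
\<close>

lemma moreau_complement_gradient:
  assumes "proper_closed_convex f" and "\<nu> > 0"
  shows "GDERIV (moreau_complement \<nu> f) u :> (1 / \<nu>) *\<^sub>R prox \<nu> f u"
  unfolding gderiv_def
proof (rule has_derivativeI_sandwich[where e = 1])
  show "bounded_linear (\<lambda>h. h \<bullet> ((1 / \<nu>) *\<^sub>R prox \<nu> f u))"
    by (rule bounded_linear_inner_left)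
  show "((\<lambda>v. norm (v - u) / \<nu>) \<longlongrightarrow> 0) (at u)"
    using \<open>\<nu> > 0\<close> by (auto intro!: tendsto_eq_intros)
  fix v assume "v \<noteq> u"
  let ?r = "moreau_complement \<nu> f v - moreau_complement \<nu> f u - (v - u) \<bullet> ((1 / \<nu>) *\<^sub>R prox \<nu> f u)"
  have "0 \<le> ?r"
    using moreau_complement_subgradient[OF assms, of u v] by (simp add: inner_commute)
  have "?r \<le> (prox \<nu> f v - prox \<nu> f u) \<bullet> (v - u) / \<nu>"
    using moreau_complement_subgradient[OF assms, of v u]
    by (simp add: inner_diff inner_commute diff_divide_distrib)
  also have "\<dots> \<le> norm (v - u) * norm (v - u) / \<nu>"
  proof (rule divide_right_mono)
    show "(prox \<nu> f v - prox \<nu> f u) \<bullet> (v - u) \<le> norm (v - u) * norm (v - u)"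
      by (rule order_trans[OF norm_cauchy_schwarz])
        (intro mult_right_mono prox_nonexpansive[OF assms] norm_ge_zero)
  qed (use \<open>\<nu> > 0\<close> in simp)
  finally have "norm ?r \<le> norm (v - u) * norm (v - u) / \<nu>"
    unfolding real_norm_def abs_of_nonneg[OF \<open>0 \<le> ?r\<close>] .
  then have "norm ?r / norm (v - u) \<le> norm (v - u) * norm (v - u) / \<nu> / norm (v - u)"
    by (rule divide_right_mono) simp
  also have "\<dots> = norm (v - u) / \<nu>"
    using \<open>v \<noteq> u\<close> by simp
  finally show "norm ?r / norm (v - u) \<le> norm (v - u) / \<nu>" .
qed simp

lemma gradient_eqI:
  assumes "GDERIV g y :> D"
  shows "gradient g y = D"
  unfolding gradient_def
proof (rule the_equality)
  show "GDERIV g y :> D" by (fact assms)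
  fix D' assume "GDERIV g y :> D'"
  then have "(\<lambda>h. h \<bullet> D') = (\<lambda>h. h \<bullet> D)"
    using assms has_derivative_unique unfolding gderiv_def by blast
  then have "(D' - D) \<bullet> (D' - D) = 0"
    by (metis inner_diff_right right_minus_eq)
  then show "D' = D" by simp
qed

lemma aug_lagrangian_gradient:
  assumes "proper_closed_convex f" and "\<sigma> > 0"
  shows "gradient (\<lambda>\<eta>. aug_lagrangian A b f \<sigma> \<eta> x) y
           = A *v prox \<sigma> f (x + \<sigma> *\<^sub>R (transpose A *v y)) - b"
proof (rule gradient_eqI)
  let ?u = "\<lambda>\<eta>. x + \<sigma> *\<^sub>R (transpose A *v \<eta>)"
  let ?p = "prox \<sigma> f (?u y)"
  have split: "(\<lambda>\<eta>. aug_lagrangian A b f \<sigma> \<eta> x)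
      = (\<lambda>\<eta>. - (b \<bullet> \<eta>) - 1 / (2 * \<sigma>) * (norm x)\<^sup>2 + moreau_complement \<sigma> f (?u \<eta>))"
    by (simp add: aug_lagrangian_def moreau_complement_def fun_eq_iff)
  have "((*v) (transpose A) has_derivative (*v) (transpose A)) (at y)"
    by (rule bounded_linear_imp_has_derivative[OF matrix_vector_mul_bounded_linear])
  from has_derivative_add[OF has_derivative_const has_derivative_scaleR_right[OF this], of x \<sigma>]
  have u: "(?u has_derivative (\<lambda>h. \<sigma> *\<^sub>R (transpose A *v h))) (at y)"
    by simp
  have "((\<lambda>\<eta>. moreau_complement \<sigma> f (?u \<eta>)) has_derivative
          (\<lambda>h. (\<sigma> *\<^sub>R (transpose A *v h)) \<bullet> ((1 / \<sigma>) *\<^sub>R ?p))) (at y)"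
    by (rule has_derivative_compose[OF u, OF moreau_complement_gradient[OF assms, unfolded gderiv_def]])
  moreover have "(\<sigma> *\<^sub>R (transpose A *v h)) \<bullet> ((1 / \<sigma>) *\<^sub>R ?p) = h \<bullet> (A *v ?p)" for h
    using \<open>\<sigma> > 0\<close> by (simp add: dot_lmul_matrix transpose_matrix_vector)
  ultimately have "((\<lambda>\<eta>. moreau_complement \<sigma> f (?u \<eta>)) has_derivative (\<lambda>h. h \<bullet> (A *v ?p))) (at y)"
    by simp
  moreover have "((\<lambda>\<eta>. - (b \<bullet> \<eta>) - 1 / (2 * \<sigma>) * (norm x)\<^sup>2) has_derivative (\<lambda>h. - (h \<bullet> b))) (at y)"
    by (auto intro!: derivative_eq_intros simp: inner_commute)
  ultimately show "GDERIV (\<lambda>\<eta>. aug_lagrangian A b f \<sigma> \<eta> x) y :> A *v ?p - b"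
    unfolding split gderiv_def by (auto dest: has_derivative_add simp: inner_diff_right)
qed

section \<open>The saddle point set\<close>

lemma dot_transpose_matrix_vector:
  fixes A :: "real ^ 'n ^ 'm"
  shows "(transpose A *v y) \<bullet> x = y \<bullet> (A *v x)"
  by (simp add: dot_lmul_matrix)

lemma saddle_points_iff:
  "(y, x) \<in> saddle_points A b f \<longleftrightarrow> A *v x = b \<and> transpose A *v y \<in> subdifferential f x"
  by (auto simp: saddle_points_def lagrangian_subgrad_def simp del: transpose_matrix_vector)

text \<open>
  The subgradient \<open>A\<^sup>T y\<close> is orthogonal to the difference of two primal feasible points, so it
  sees both saddle points at the same level.
\<close>

lemma saddle_points_value_eq:
  assumes "proper_fun f" and "(y\<^sub>1, x\<^sub>1) \<in> saddle_points A b f" and "(y\<^sub>2, x\<^sub>2) \<in> saddle_points A b f"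
  shows "f x\<^sub>1 = f x\<^sub>2"
proof -
  have le: "f x \<le> f x'" if z: "(y, x) \<in> saddle_points A b f" and z': "(y', x') \<in> saddle_points A b f"
    for y x y' x'
  proof -
    have "f x + ereal ((transpose A *v y) \<bullet> (x' - x)) \<le> f x'"
      using z by (simp add: saddle_points_iff subdifferential_def del: transpose_matrix_vector)
    moreover have "(transpose A *v y) \<bullet> (x' - x) = 0"
      using z z' by (simp only: dot_transpose_matrix_vector)
        (simp add: saddle_points_iff matrix_vector_mult_diff_distrib)
    ultimately show ?thesis by simp
  qed
  show ?thesis using le[OF assms(2,3)] le[OF assms(3,2)] by (rule antisym)
qed

text \<open>
  This says that the saddle point set is the product of its two projections.
\<close>

lemma saddle_points_exchange:
  assumes "proper_fun f" and z1: "(y\<^sub>1, x\<^sub>1) \<in> saddle_points A b f" and z2: "(y\<^sub>2, x\<^sub>2) \<in> saddle_points A b f"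
  shows "(y\<^sub>1, x\<^sub>2) \<in> saddle_points A b f"
proof -
  have "f x\<^sub>2 + ereal ((transpose A *v y\<^sub>1) \<bullet> (z - x\<^sub>2)) \<le> f z" for z
  proof -
    have "(transpose A *v y\<^sub>1) \<bullet> (z - x\<^sub>2) = (transpose A *v y\<^sub>1) \<bullet> (z - x\<^sub>1)"
      using z1 z2 by (simp only: dot_transpose_matrix_vector)
        (simp add: saddle_points_iff matrix_vector_mult_diff_distrib)
    moreover have "f x\<^sub>1 + ereal ((transpose A *v y\<^sub>1) \<bullet> (z - x\<^sub>1)) \<le> f z"
      using z1 by (simp add: saddle_points_iff subdifferential_def del: transpose_matrix_vector)
    ultimately show ?thesis using saddle_points_value_eq[OF assms] by simp
  qed
  with z2 show ?thesis
    by (simp add: saddle_points_iff subdifferential_def del: transpose_matrix_vector)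
qed

text \<open>
  By the exchange property the primal component may be fixed at one solution, after which the
  subgradient inequality is linear in the multiplier. Points outside the effective domain impose
  no condition; on the domain \<open>f\<close> is real-valued.
\<close>

lemma dual_solutions_halfspaces:
  assumes "proper_fun f" and z0: "(y0, x0) \<in> saddle_points A b f" and s: "f x0 = ereal s"
  shows "fst ` saddle_points A b f
           = (\<Inter>z\<in>{z. f z < \<infinity>}. {y. (A *v (z - x0)) \<bullet> y \<le> real_of_ereal (f z) - s})"
proof -
  have ninf: "\<And>z. f z \<noteq> -\<infinity>" using assms(1) by (simp add: proper_fun_def)
  have half: "f x0 + ereal ((transpose A *v y) \<bullet> (z - x0)) \<le> f z
      \<longleftrightarrow> (f z < \<infinity> \<longrightarrow> (A *v (z - x0)) \<bullet> y \<le> real_of_ereal (f z) - s)" for y z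
    using ninf[of z] unfolding dot_transpose_matrix_vector s
    by (cases "f z") (auto simp: inner_commute)
  have "y \<in> fst ` saddle_points A b f \<longleftrightarrow> (y, x0) \<in> saddle_points A b f" for y
    using saddle_points_exchange[OF assms(1) _ z0] by force
  then show ?thesis
    using z0 half
    by (auto simp: saddle_points_iff subdifferential_def simp del: transpose_matrix_vector)
qed

lemma dual_solutions_closed_convex:
  assumes "proper_fun f" and "saddle_points A b f \<noteq> {}"
  shows "closed (fst ` saddle_points A b f)" and "convex (fst ` saddle_points A b f)"
proof -
  obtain y0 x0 where z0: "(y0, x0) \<in> saddle_points A b f" using assms(2) by auto
  then obtain s where "f x0 = ereal s"
    using subdifferential_finite[OF assms(1)] by (auto simp: saddle_points_iff)
  note eq = dual_solutions_halfspaces[OF assms(1) z0 this]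
  show "closed (fst ` saddle_points A b f)" "convex (fst ` saddle_points A b f)"
    unfolding eq by (auto intro!: closed_INT closed_halfspace_le convex_INT convex_halfspace_le)
qed

section \<open>Weighted distances to a set\<close>

text \<open>
  A real-valued version of the distance; it is faithful for a nonempty set and a nonnegative
  weight, as \<open>wdist_to_eq\<close> below shows.
\<close>

definition weighted_dist ::
    "real \<Rightarrow> (real ^ 'm) \<times> (real ^ 'n) \<Rightarrow> ((real ^ 'm) \<times> (real ^ 'n)) set \<Rightarrow> real" where
  "weighted_dist t z S = real_of_ereal (wdist_to (diag_op t) z S)"

lemma wnorm_diag_sq:
  assumes "t \<ge> 0"
  shows "(wnorm (diag_op t) (y, x))\<^sup>2 = t * (norm y)\<^sup>2 + (norm x)\<^sup>2"
  using assms by (simp add: wnorm_def diag_op_def power2_norm_eq_inner)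

lemma wnorm_diag_nonneg:
  assumes "t \<ge> 0"
  shows "0 \<le> wnorm (diag_op t) z"
  using assms by (cases z) (simp add: wnorm_def diag_op_def)

lemma
  assumes "t \<ge> 0" and "S \<noteq> {}"
  shows wdist_to_eq: "wdist_to (diag_op t) z S = ereal (weighted_dist t z S)"
    and weighted_dist_nonneg: "0 \<le> weighted_dist t z S"
proof -
  obtain s where "s \<in> S" using assms(2) by auto
  then have "wdist_to (diag_op t) z S \<le> ereal (wnorm (diag_op t) (z - s))"
    unfolding wdist_to_def by (rule INF_lower)
  moreover have "0 \<le> wdist_to (diag_op t) z S"
    unfolding wdist_to_def by (rule INF_greatest) (simp add: wnorm_diag_nonneg[OF assms(1)])
  ultimately show "wdist_to (diag_op t) z S = ereal (weighted_dist t z S)" "0 \<le> weighted_dist t z S"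
    by (cases "wdist_to (diag_op t) z S"; simp add: weighted_dist_def)+
qed

lemma weighted_dist_le:
  assumes "t \<ge> 0" and "s \<in> S"
  shows "weighted_dist t z S \<le> wnorm (diag_op t) (z - s)"
proof -
  have "wdist_to (diag_op t) z S \<le> ereal (wnorm (diag_op t) (z - s))"
    unfolding wdist_to_def using assms(2) by (rule INF_lower)
  moreover have "S \<noteq> {}" using assms(2) by auto
  ultimately show ?thesis using wdist_to_eq[OF assms(1), of S z] by simp
qed

text \<open>
  Together with \<open>weighted_dist_le\<close> this characterizes the distance as a greatest lower bound, so
  no point of the set needs to attain it.
\<close>

lemma weighted_dist_greatest:
  assumes "t \<ge> 0" and "S \<noteq> {}" and "\<And>s. s \<in> S \<Longrightarrow> e \<le> wnorm (diag_op t) (z - s)"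
  shows "e \<le> weighted_dist t z S"
proof -
  have "ereal e \<le> wdist_to (diag_op t) z S"
    unfolding wdist_to_def by (rule INF_greatest) (simp add: assms(3))
  then show ?thesis using wdist_to_eq[OF assms(1,2)] by simp
qed

lemma wnorm_diag_le_norm:
  assumes "t \<ge> 0"
  shows "wnorm (diag_op t) z \<le> sqrt (max 1 t) * norm z"
proof (rule power2_le_imp_le)
  obtain y x where z: "z = (y, x)" by (cases z)
  have "t * (norm y)\<^sup>2 + (norm x)\<^sup>2 \<le> max 1 t * (norm y)\<^sup>2 + max 1 t * (norm x)\<^sup>2"
    by (intro add_mono mult_right_mono) (simp_all add: mult_le_cancel_right1)
  then show "(wnorm (diag_op t) z)\<^sup>2 \<le> (sqrt (max 1 t) * norm z)\<^sup>2"
    by (simp add: z wnorm_diag_sq[OF assms] power_mult_distrib norm_Pair distrib_left)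
qed simp

lemma weighted_dist_le_dist_to:
  assumes "t \<ge> 0" and "S \<noteq> {}" and "dist_to z S \<le> ereal e"
  shows "weighted_dist t z S \<le> sqrt (max 1 t) * e"
proof -
  have "weighted_dist t z S / sqrt (max 1 t) \<le> dist z s" if "s \<in> S" for s
  proof -
    have "weighted_dist t z S \<le> sqrt (max 1 t) * dist z s"
      using order_trans[OF weighted_dist_le[OF assms(1) that] wnorm_diag_le_norm[OF assms(1)]]
      by (simp add: dist_norm)
    then show ?thesis by (simp add: pos_divide_le_eq mult.commute)
  qed
  then have "ereal (weighted_dist t z S / sqrt (max 1 t)) \<le> dist_to z S"
    unfolding dist_to_def by (intro INF_greatest) simp
  then have "ereal (weighted_dist t z S / sqrt (max 1 t)) \<le> ereal e"
    using assms(3) by (rule order_trans)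
  then show ?thesis by (simp add: pos_divide_le_eq mult.commute)
qed

lemma weighted_dist_reweight:
  assumes "t \<ge> 0" "t' \<ge> 0" "t' \<le> (1 + n) * t" "n \<ge> 0" and "S \<noteq> {}"
  shows "weighted_dist t' z S \<le> sqrt (1 + n) * weighted_dist t z S"
proof -
  have "weighted_dist t' z S / sqrt (1 + n) \<le> wnorm (diag_op t) (z - s)" if "s \<in> S" for s
  proof -
    obtain v u where vu: "z - s = (v, u)" by (cases "z - s")
    have "wnorm (diag_op t') (z - s) \<le> sqrt (1 + n) * wnorm (diag_op t) (z - s)"
    proof (rule power2_le_imp_le)
      have "t' * (norm v)\<^sup>2 + (norm u)\<^sup>2 \<le> ((1 + n) * t) * (norm v)\<^sup>2 + (1 + n) * (norm u)\<^sup>2"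
        using assms by (intro add_mono mult_right_mono) (simp_all add: mult_le_cancel_right1)
      then show "(wnorm (diag_op t') (z - s))\<^sup>2 \<le> (sqrt (1 + n) * wnorm (diag_op t) (z - s))\<^sup>2"
        using assms by (simp add: vu wnorm_diag_sq power_mult_distrib algebra_simps)
    qed (use assms in \<open>simp add: wnorm_diag_nonneg\<close>)
    with weighted_dist_le[OF assms(2) that, of z] show ?thesis
      using assms by (simp add: pos_divide_le_eq mult.commute)
  qed
  then have "weighted_dist t' z S / sqrt (1 + n) \<le> weighted_dist t z S"
    by (rule weighted_dist_greatest[OF assms(1,5)])
  then show ?thesis using assms by (simp add: pos_divide_le_eq mult.commute)
qed

section \<open>One inexact proximal step\<close>

text \<open>
  One step of an inexact proximal point method for \<open>\<partial>\<ell>\<close> in the metric weighted by \<open>\<tau>\<close>, with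
  relative accuracy \<open>\<rho>\<close>; the residual \<open>\<Delta>\<close> perturbs the dual equation only.
\<close>

locale inexact_proximal_step =
  fixes A :: "real ^ 'n ^ 'm" and b :: "real ^ 'm" and f :: "real ^ 'n \<Rightarrow> ereal"
    and \<sigma> \<tau> \<rho> :: real and y y' \<Delta> :: "real ^ 'm" and x x' :: "real ^ 'n"
  assumes proper: "proper_fun f" and \<sigma>_pos: "\<sigma> > 0" and \<tau>_pos: "\<tau> > 0" and \<rho>_nonneg: "\<rho> \<ge> 0"
    and inclusion: "(\<Delta> + (\<tau> / \<sigma>) *\<^sub>R (y - y'), (1 / \<sigma>) *\<^sub>R (x - x')) \<in> lagrangian_subgrad A b f (y', x')"
    and accuracy: "(norm (\<sigma> *\<^sub>R \<Delta>))\<^sup>2 \<le> \<rho> * ((norm (x' - x))\<^sup>2 + \<tau> * (norm (y' - y))\<^sup>2)"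
begin

abbreviation \<Omega> :: "((real ^ 'm) \<times> (real ^ 'n)) set" where
  "\<Omega> \<equiv> saddle_points A b f"

definition step_length :: real where
  "step_length = wnorm (diag_op \<tau>) ((y', x') - (y, x))"

lemma step_length_sq: "step_length\<^sup>2 = \<tau> * (norm (y' - y))\<^sup>2 + (norm (x' - x))\<^sup>2"
  using \<tau>_pos by (simp add: step_length_def wnorm_diag_sq)

lemma step_length_nonneg: "0 \<le> step_length"
  using \<tau>_pos by (simp add: step_length_def wnorm_diag_nonneg)

lemma scaled_residual_le: "norm (\<sigma> *\<^sub>R \<Delta>) \<le> sqrt \<rho> * step_length"
proof (rule power2_le_imp_le)
  show "(norm (\<sigma> *\<^sub>R \<Delta>))\<^sup>2 \<le> (sqrt \<rho> * step_length)\<^sup>2"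
    using accuracy \<rho>_nonneg by (simp only: power_mult_distrib step_length_sq) (simp add: add.commute)
qed (simp add: \<rho>_nonneg step_length_nonneg)

lemma dual_step_le: "norm (y' - y) \<le> step_length / sqrt \<tau>"
proof -
  have "sqrt \<tau> * norm (y' - y) \<le> step_length"
    by (rule power2_le_imp_le)
      (use \<tau>_pos in \<open>simp_all add: step_length_sq step_length_nonneg power_mult_distrib\<close>)
  then show ?thesis using \<tau>_pos by (simp add: pos_le_divide_eq mult.commute)
qed

lemma monotonicity:
  assumes "(ys, xs) \<in> \<Omega>"
  shows "0 \<le> (y' - ys) \<bullet> (\<sigma> *\<^sub>R \<Delta> + \<tau> *\<^sub>R (y - y')) + (x' - xs) \<bullet> (x - x')"
proof -
  from inclusion obtain v where v: "v \<in> subdifferential f x'"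
    and v_eq: "v - transpose A *v y' = (1 / \<sigma>) *\<^sub>R (x - x')"
    and res: "A *v x' - b = \<Delta> + (\<tau> / \<sigma>) *\<^sub>R (y - y')"
    by (auto simp: lagrangian_subgrad_def simp del: transpose_matrix_vector)
  have "0 \<le> (v - transpose A *v ys) \<bullet> (x' - xs)"
    by (rule subdifferential_monotone[OF proper v]) (use assms in \<open>simp add: saddle_points_iff\<close>)
  also have "v - transpose A *v ys = (1 / \<sigma>) *\<^sub>R (x - x') + transpose A *v (y' - ys)"
    using v_eq by (simp add: matrix_vector_mult_diff_distrib algebra_simps del: transpose_matrix_vector)
  also have "\<dots> \<bullet> (x' - xs) = (1 / \<sigma>) * ((x - x') \<bullet> (x' - xs)) + (y' - ys) \<bullet> (A *v x' - A *v xs)"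
    by (simp only: inner_add_left inner_scaleR_left dot_transpose_matrix_vector
        matrix_vector_mult_diff_distrib[of A])
  also have "A *v x' - A *v xs = \<Delta> + (\<tau> / \<sigma>) *\<^sub>R (y - y')"
    using assms res by (simp add: saddle_points_iff)
  finally have "0 \<le> \<sigma> * ((1 / \<sigma>) * ((x - x') \<bullet> (x' - xs)) + (y' - ys) \<bullet> (\<Delta> + (\<tau> / \<sigma>) *\<^sub>R (y - y')))"
    using \<sigma>_pos by simp
  then show ?thesis
    using \<sigma>_pos by (simp add: inner_add_right distrib_left inner_commute)
qed

text \<open>
  Monotonicity of \<open>\<partial>\<ell>\<close> between \<open>z'\<close> and a saddle point, combined with the three-point identity
  in each component.
\<close>

lemma perturbed_fejer:
  assumes "(ys, xs) \<in> \<Omega>"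
  shows "(wnorm (diag_op \<tau>) ((y', x') - (ys, xs)))\<^sup>2 + step_length\<^sup>2
           \<le> (wnorm (diag_op \<tau>) ((y, x) - (ys, xs)))\<^sup>2 + 2 * ((y' - ys) \<bullet> (\<sigma> *\<^sub>R \<Delta>))"
proof -
  have expand: "(norm (u - s))\<^sup>2 = (norm (u' - s))\<^sup>2 + (norm (u' - u))\<^sup>2 + 2 * ((u' - s) \<bullet> (u - u'))"
    for u u' s :: "real ^ 'k"
    by (simp add: power2_norm_eq_inner inner_diff inner_commute)
  have "0 \<le> (y' - ys) \<bullet> (\<sigma> *\<^sub>R \<Delta>) + \<tau> * ((y' - ys) \<bullet> (y - y')) + (x' - xs) \<bullet> (x - x')"
    using monotonicity[OF assms] by (simp add: inner_add_right)
  moreover have "\<tau> * (norm (y - ys))\<^sup>2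
      = \<tau> * (norm (y' - ys))\<^sup>2 + \<tau> * (norm (y' - y))\<^sup>2 + 2 * (\<tau> * ((y' - ys) \<bullet> (y - y')))"
    unfolding expand[of y ys y'] by (simp only: distrib_left mult.left_commute[of \<tau>])
  ultimately show ?thesis
    unfolding diff_Pair wnorm_diag_sq[OF less_imp_le[OF \<tau>_pos]] step_length_sq
    using expand[of x xs x'] by linarith
qed

text \<open>
  The subgradient of the inclusion has norm at most \<open>(sqrt \<rho> + sqrt (max 1 \<tau>)) / \<sigma>\<close> times the
  step length: the first summand stems from \<open>\<Delta>\<close>, the second from comparing the weighted
  displacement with the weighted norm.
\<close>

lemma subgradient_bound:
  "dist_to (0, 0) (lagrangian_subgrad A b f (y', x'))
     \<le> ereal ((sqrt \<rho> + sqrt (max 1 \<tau>)) / \<sigma> * step_length)"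
proof -
  let ?g = "(\<Delta> + (\<tau> / \<sigma>) *\<^sub>R (y - y'), (1 / \<sigma>) *\<^sub>R (x - x'))"
  have "\<sigma> *\<^sub>R ?g = (\<sigma> *\<^sub>R \<Delta>, 0) + (\<tau> *\<^sub>R (y - y'), x - x')"
    using \<sigma>_pos by (simp add: scaleR_add_right)
  then have "\<sigma> * norm ?g = norm ((\<sigma> *\<^sub>R \<Delta>, 0) + (\<tau> *\<^sub>R (y - y'), x - x'))"
    using \<sigma>_pos by (metis abs_of_pos norm_scaleR)
  also have "\<dots> \<le> norm (\<sigma> *\<^sub>R \<Delta>, 0 :: real ^ 'n) + norm (\<tau> *\<^sub>R (y - y'), x - x')"
    by (rule norm_triangle_ineq)
  also have "\<dots> \<le> sqrt \<rho> * step_length + sqrt (max 1 \<tau>) * step_length"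
  proof (rule add_mono)
    show "norm (\<sigma> *\<^sub>R \<Delta>, 0 :: real ^ 'n) \<le> sqrt \<rho> * step_length"
      using scaled_residual_le by (simp add: norm_Pair)
    show "norm (\<tau> *\<^sub>R (y - y'), x - x') \<le> sqrt (max 1 \<tau>) * step_length"
    proof (rule power2_le_imp_le)
      have "\<tau> * (\<tau> * (norm (y' - y))\<^sup>2) \<le> max 1 \<tau> * (\<tau> * (norm (y' - y))\<^sup>2)"
        using \<tau>_pos by (intro mult_right_mono) auto
      moreover have "(norm (x' - x))\<^sup>2 \<le> max 1 \<tau> * (norm (x' - x))\<^sup>2"
        by (simp add: mult_le_cancel_right1)
      moreover have "(norm (\<tau> *\<^sub>R (y - y'), x - x'))\<^sup>2
          = \<tau> * (\<tau> * (norm (y' - y))\<^sup>2) + (norm (x' - x))\<^sup>2"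
        by (simp add: norm_Pair norm_minus_commute power_mult_distrib power2_eq_square)
      ultimately show "(norm (\<tau> *\<^sub>R (y - y'), x - x'))\<^sup>2 \<le> (sqrt (max 1 \<tau>) * step_length)\<^sup>2"
        by (simp only: power_mult_distrib step_length_sq) (simp add: distrib_left)
    qed (simp add: step_length_nonneg)
  qed
  finally have g: "norm ?g \<le> (sqrt \<rho> + sqrt (max 1 \<tau>)) / \<sigma> * step_length"
    using \<sigma>_pos by (simp add: field_simps)
  have "dist_to (0, 0) (lagrangian_subgrad A b f (y', x')) \<le> ereal (dist (0, 0) ?g)"
    unfolding dist_to_def using inclusion by (rule INF_lower)
  also have "dist (0, 0) ?g = norm (- ?g)" by (simp add: dist_norm)
  also have "norm (- ?g) = norm ?g" by (rule norm_minus_cancel)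
  also have "ereal (norm ?g) \<le> ereal ((sqrt \<rho> + sqrt (max 1 \<tau>)) / \<sigma> * step_length)"
    unfolding ereal_less_eq by (rule g)
  finally show ?thesis .
qed

end

locale inexact_proximal_step_error_bound = inexact_proximal_step +
  fixes \<kappa> r :: real
  assumes saddle: "\<Omega> \<noteq> {}" and \<kappa>_pos: "\<kappa> > 0" and bound: "error_bound A b f r \<kappa>"
    and near: "dist_to (y', x') \<Omega> \<le> ereal r"
begin

text \<open>
  The factor by which the step length bounds the distance of the new iterate to the saddle
  points.
\<close>

definition error_modulus :: real where
  "error_modulus = \<kappa> * (sqrt \<rho> + sqrt (max 1 \<tau>)) / \<sigma>"

lemma error_modulus_pos: "error_modulus > 0"
proof -
  have "sqrt \<rho> + sqrt (max 1 \<tau>) > 0" using \<rho>_nonneg by (simp add: add_nonneg_pos)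
  then show ?thesis using \<kappa>_pos \<sigma>_pos by (simp add: error_modulus_def)
qed

lemma error_le: "dist_to (y', x') \<Omega> \<le> ereal (error_modulus * step_length)"
proof -
  have "dist_to (y', x') \<Omega> \<le> ereal \<kappa> * dist_to (0, 0) (lagrangian_subgrad A b f (y', x'))"
    using bound near by (simp add: error_bound_def)
  also have "\<dots> \<le> ereal \<kappa> * ereal ((sqrt \<rho> + sqrt (max 1 \<tau>)) / \<sigma> * step_length)"
    using \<kappa>_pos by (intro ereal_mult_left_mono subgradient_bound) simp
  finally show ?thesis by (simp add: error_modulus_def mult.assoc)
qed

text \<open>
  The projection of \<open>y'\<close> is close to \<open>y'\<close> by the error bound, and the projections of \<open>y\<close> and \<open>y'\<close>
  are no further apart than the dual step.
\<close>

lemma dual_projection_error: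
  "norm (y' - closest_point (fst ` \<Omega>) y) \<le> (error_modulus + 1 / sqrt \<tau>) * step_length"
proof -
  let ?P = "closest_point (fst ` \<Omega>)"
  note cc = dual_solutions_closed_convex[OF proper saddle]
  have "dist y' (?P y') \<le> dist (y', x') s" if "s \<in> \<Omega>" for s
  proof -
    have "dist y' (?P y') \<le> dist y' (fst s)" using cc(1) that by (intro closest_point_le) auto
    also have "\<dots> \<le> dist (y', x') s" by (metis dist_fst_le fst_conv)
    finally show ?thesis .
  qed
  then have "ereal (dist y' (?P y')) \<le> dist_to (y', x') \<Omega>"
    unfolding dist_to_def by (intro INF_greatest) simp
  also note error_le
  finally have "dist y' (?P y') \<le> error_modulus * step_length" by simp
  moreover have "dist (?P y') (?P y) \<le> dist y' y"
    using cc saddle by (intro closest_point_lipschitz) auto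
  then have "dist (?P y') (?P y) \<le> step_length / sqrt \<tau>"
    using dual_step_le by (simp add: dist_norm)
  ultimately show ?thesis
    using dist_triangle[of y' "?P y" "?P y'"] by (simp add: dist_norm distrib_right)
qed

text \<open>
  The fraction of the squared step length that remains in the Fejer inequality after the error term
  has been absorbed.
\<close>

definition decrease_factor :: real where
  "decrease_factor = 1 - 2 * sqrt \<rho> * (error_modulus + 1 / sqrt \<tau>)"

text \<open>
  Given \<open>s = (s\<^sub>y, s\<^sub>x)\<close>, take \<open>z = (P y, s\<^sub>x)\<close> with \<open>P\<close> the projection onto the dual solutions.
  It is a saddle point by the exchange property, it is at least as close to the current iterate
  as \<open>s\<close>, and its dual component is close enough to \<open>y'\<close> to control the error term.
\<close>

lemma sufficient_decrease:
  assumes "s \<in> \<Omega>"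
  obtains z where "z \<in> \<Omega>"
    and "(wnorm (diag_op \<tau>) ((y', x') - z))\<^sup>2 + decrease_factor * step_length\<^sup>2
           \<le> (wnorm (diag_op \<tau>) ((y, x) - s))\<^sup>2"
proof -
  obtain ys xs where s: "s = (ys, xs)" by (cases s)
  let ?p = "closest_point (fst ` \<Omega>) y"
  have closed: "closed (fst ` \<Omega>)" by (rule dual_solutions_closed_convex[OF proper saddle])
  then have "?p \<in> fst ` \<Omega>" using saddle by (intro closest_point_in_set) auto
  then obtain u where "(?p, u) \<in> \<Omega>" by force
  then have p: "(?p, xs) \<in> \<Omega>" using assms unfolding s by (rule saddle_points_exchange[OF proper])
  have "(y' - ?p) \<bullet> (\<sigma> *\<^sub>R \<Delta>) \<le> norm (y' - ?p) * norm (\<sigma> *\<^sub>R \<Delta>)"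
    by (rule norm_cauchy_schwarz)
  also have "\<dots> \<le> ((error_modulus + 1 / sqrt \<tau>) * step_length) * (sqrt \<rho> * step_length)"
    by (intro mult_mono' dual_projection_error scaled_residual_le norm_ge_zero)
  finally have "2 * ((y' - ?p) \<bullet> (\<sigma> *\<^sub>R \<Delta>))
      \<le> 2 * (((error_modulus + 1 / sqrt \<tau>) * step_length) * (sqrt \<rho> * step_length))"
    by (rule mult_left_mono) simp
  also have "\<dots> = (1 - decrease_factor) * step_length\<^sup>2"
    by (simp add: decrease_factor_def power2_eq_square)
  finally have "2 * ((y' - ?p) \<bullet> (\<sigma> *\<^sub>R \<Delta>)) \<le> (1 - decrease_factor) * step_length\<^sup>2" .
  moreover have "(wnorm (diag_op \<tau>) ((y, x) - (?p, xs)))\<^sup>2 \<le> (wnorm (diag_op \<tau>) ((y, x) - s))\<^sup>2"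
  proof -
    have "dist y ?p \<le> dist y ys"
      using closed assms s by (intro closest_point_le) force+
    then have "\<tau> * (norm (y - ?p))\<^sup>2 \<le> \<tau> * (norm (y - ys))\<^sup>2"
      using \<tau>_pos by (intro mult_left_mono power_mono) (auto simp: dist_norm)
    then show ?thesis using \<tau>_pos by (simp add: s wnorm_diag_sq)
  qed
  ultimately have "(wnorm (diag_op \<tau>) ((y', x') - (?p, xs)))\<^sup>2 + decrease_factor * step_length\<^sup>2
      \<le> (wnorm (diag_op \<tau>) ((y, x) - s))\<^sup>2"
    using perturbed_fejer[OF p] unfolding left_diff_distrib mult_1 by linarith
  with p show thesis by (rule that)
qed

lemma step_length_le_dist:
  assumes "decrease_factor \<ge> 0"
  shows "sqrt decrease_factor * step_length \<le> weighted_dist \<tau> (y, x) \<Omega>"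
proof (rule weighted_dist_greatest)
  fix s assume "s \<in> \<Omega>"
  then obtain z where "(wnorm (diag_op \<tau>) ((y', x') - z))\<^sup>2 + decrease_factor * step_length\<^sup>2
           \<le> (wnorm (diag_op \<tau>) ((y, x) - s))\<^sup>2"
    by (rule sufficient_decrease)
  then have "decrease_factor * step_length\<^sup>2 \<le> (wnorm (diag_op \<tau>) ((y, x) - s))\<^sup>2"
    by (rule order_trans[rotated]) simp
  then show "sqrt decrease_factor * step_length \<le> wnorm (diag_op \<tau>) ((y, x) - s)"
    using assms \<tau>_pos
    by - (rule power2_le_imp_le, simp_all add: power_mult_distrib wnorm_diag_nonneg)
qed (use \<tau>_pos saddle in auto)

text \<open>
  By the error bound, \<open>D\<^sup>2 \<ge> d\<^sup>2 / (a\<^sup>2 max 1 \<tau>)\<close> for the distance \<open>d\<close> of the new iterate, so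
  the decrease \<open>\<theta> * D\<^sup>2\<close> is a multiple of \<open>d\<^sup>2\<close>.
\<close>

lemma contraction:
  assumes "decrease_factor \<ge> 0"
  shows "sqrt (1 + decrease_factor / (error_modulus\<^sup>2 * max 1 \<tau>)) * weighted_dist \<tau> (y', x') \<Omega>
           \<le> weighted_dist \<tau> (y, x) \<Omega>"
proof (rule weighted_dist_greatest)
  define d where "d = weighted_dist \<tau> (y', x') \<Omega>"
  define g where "g = decrease_factor / (error_modulus\<^sup>2 * max 1 \<tau>)"
  have g: "g \<ge> 0" using assms by (simp add: g_def)
  have d: "d \<ge> 0" unfolding d_def using \<tau>_pos saddle by (intro weighted_dist_nonneg) auto
  have "d \<le> sqrt (max 1 \<tau>) * (error_modulus * step_length)"
    unfolding d_def using \<tau>_pos saddle error_le by (intro weighted_dist_le_dist_to) auto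
  then have "d\<^sup>2 \<le> (sqrt (max 1 \<tau>) * (error_modulus * step_length))\<^sup>2"
    using d by (rule power_mono)
  also have "\<dots> = (error_modulus\<^sup>2 * max 1 \<tau>) * step_length\<^sup>2"
    by (simp add: power_mult_distrib)
  finally have "g * d\<^sup>2 \<le> g * ((error_modulus\<^sup>2 * max 1 \<tau>) * step_length\<^sup>2)"
    using g by (rule mult_left_mono)
  also have "\<dots> = (g * (error_modulus\<^sup>2 * max 1 \<tau>)) * step_length\<^sup>2"
    by (simp only: mult.assoc)
  also have "g * (error_modulus\<^sup>2 * max 1 \<tau>) = decrease_factor"
    using error_modulus_pos by (simp add: g_def)
  finally have gd: "g * d\<^sup>2 \<le> decrease_factor * step_length\<^sup>2" .
  fix s assume "s \<in> \<Omega>"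
  then obtain z where z: "z \<in> \<Omega>" and dec: "(wnorm (diag_op \<tau>) ((y', x') - z))\<^sup>2
      + decrease_factor * step_length\<^sup>2 \<le> (wnorm (diag_op \<tau>) ((y, x) - s))\<^sup>2"
    by (rule sufficient_decrease)
  have "d \<le> wnorm (diag_op \<tau>) ((y', x') - z)"
    unfolding d_def using \<tau>_pos z by (intro weighted_dist_le) auto
  then have "d\<^sup>2 \<le> (wnorm (diag_op \<tau>) ((y', x') - z))\<^sup>2" using d by (rule power_mono)
  then have "(1 + g) * d\<^sup>2 \<le> (wnorm (diag_op \<tau>) ((y, x) - s))\<^sup>2"
    using gd dec by (simp add: distrib_right)
  then show "sqrt (1 + decrease_factor / (error_modulus\<^sup>2 * max 1 \<tau>)) * weighted_dist \<tau> (y', x') \<Omega>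
      \<le> wnorm (diag_op \<tau>) ((y, x) - s)"
    unfolding d_def[symmetric] g_def[symmetric] using g \<tau>_pos
    by - (rule power2_le_imp_le, simp_all add: power_mult_distrib wnorm_diag_nonneg)
qed (use \<tau>_pos saddle in auto)

lemma decrease_factor_eq:
  "1 - (2 * \<kappa> * sqrt \<tau> * (\<rho> + sqrt (\<rho> * max 1 \<tau>)) + 2 * \<sigma> * sqrt \<rho>) / (\<sigma> * sqrt \<tau>)
     = decrease_factor"
proof -
  have "\<rho> + sqrt (\<rho> * max 1 \<tau>) = sqrt \<rho> * (sqrt \<rho> + sqrt (max 1 \<tau>))"
    using \<rho>_nonneg by (simp add: distrib_left real_sqrt_mult)
  then show ?thesis
    unfolding decrease_factor_def error_modulus_def
    using \<sigma>_pos \<tau>_pos by (simp add: divide_simps) (simp add: algebra_simps)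
qed

lemma inverse_error_modulus_eq:
  "\<sigma>\<^sup>2 / (\<kappa>\<^sup>2 * (sqrt \<rho> + sqrt (max 1 \<tau>))\<^sup>2 * max 1 \<tau>) = 1 / (error_modulus\<^sup>2 * max 1 \<tau>)"
  by (simp add: error_modulus_def power_divide power_mult_distrib)

text \<open>
  With \<open>G = sqrt \<tau>min - 2 sqrt \<rho>\<close>, the two terms subtracted from 1 in the decrease factor are at
  most \<open>G / (c sqrt \<tau>min)\<close>, by the size of \<open>\<sigma>\<close>, and \<open>1 - G / sqrt \<tau>min\<close>.
\<close>

lemma decrease_factor_lower_bound:
  fixes c \<tau>min \<tau>max :: real
  assumes "c > 1" and "\<tau>min > 0" and "\<tau>min \<le> \<tau>" and "\<tau> \<le> \<tau>max"
    and gap: "sqrt \<tau>min - 2 * sqrt \<rho> > 0"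
    and large: "c * (2 * \<kappa> * sqrt \<tau>max * (\<rho> + sqrt (\<rho> * max 1 \<tau>max)) / (sqrt \<tau>min - 2 * sqrt \<rho>)) < \<sigma>"
  shows "(c - 1) / c * ((sqrt \<tau>min - 2 * sqrt \<rho>) / sqrt \<tau>min) \<le> decrease_factor"
proof -
  define G where "G = sqrt \<tau>min - 2 * sqrt \<rho>"
  define B where "B = \<rho> + sqrt (\<rho> * max 1 \<tau>max)"
  have G: "G > 0" using gap by (simp add: G_def)
  have sm: "sqrt \<tau>min > 0" "sqrt \<tau>min \<le> sqrt \<tau>" "sqrt \<tau>min \<le> sqrt \<tau>max" using assms by auto
  have B: "B \<ge> 0" using \<rho>_nonneg assms(2-4) by (simp add: B_def)
  \<comment> \<open>the term with the error modulus, controlled by the size of \<open>\<sigma>\<close>\<close>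
  have "2 * sqrt \<rho> * error_modulus = 2 * \<kappa> * (\<rho> + sqrt (\<rho> * max 1 \<tau>)) / \<sigma>"
    using \<rho>_nonneg by (simp add: error_modulus_def real_sqrt_mult distrib_left mult.assoc mult.left_commute)
  also have "\<dots> \<le> 2 * \<kappa> * B / \<sigma>"
    using \<rho>_nonneg \<kappa>_pos \<sigma>_pos assms(4)
    by (intro divide_right_mono mult_left_mono) (auto simp: B_def intro!: mult_left_mono)
  also have "\<dots> \<le> G / (c * sqrt \<tau>min)"
  proof -
    have "(c * sqrt \<tau>min) * (2 * \<kappa> * B) \<le> (c * sqrt \<tau>max) * (2 * \<kappa> * B)"
      using sm(3) B \<kappa>_pos assms(1) by (intro mult_right_mono) auto
    also have "\<dots> = c * (2 * \<kappa> * sqrt \<tau>max * B / G) * G"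
      using G by simp
    also have "\<dots> \<le> \<sigma> * G"
      using large G unfolding B_def[symmetric] G_def[symmetric] by (intro mult_right_mono) auto
    finally show ?thesis
      using sm(1) assms(1) \<sigma>_pos by (simp add: divide_simps mult.commute mult.left_commute)
  qed
  finally have 1: "2 * sqrt \<rho> * error_modulus \<le> G / (c * sqrt \<tau>min)" .
  have "2 * sqrt \<rho> * (1 / sqrt \<tau>) \<le> 2 * sqrt \<rho> * (1 / sqrt \<tau>min)"
    using sm \<rho>_nonneg by (intro mult_left_mono divide_left_mono) auto
  also have "\<dots> = 1 - G / sqrt \<tau>min"
    using sm(1) by (simp add: G_def field_simps)
  finally have 2: "2 * sqrt \<rho> * (1 / sqrt \<tau>) \<le> 1 - G / sqrt \<tau>min" .
  have "(c - 1) / c * (G / sqrt \<tau>min) = G / sqrt \<tau>min - G / (c * sqrt \<tau>min)"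
    using assms(1) sm(1) by (simp add: field_simps)
  then show ?thesis
    using 1 2 unfolding decrease_factor_def G_def[symmetric] distrib_left[of "2 * sqrt \<rho>"] by linarith
qed

end

section \<open>ripALM as a sequence of inexact proximal steps\<close>

lemma ripALM_inclusion:
  fixes A :: "real ^ 'n ^ 'm" and y y' :: "real ^ 'm"
  assumes "proper_closed_convex f" and "\<sigma> > 0"
    and x': "x' = prox \<sigma> f (x + \<sigma> *\<^sub>R (transpose A *v y'))"
  shows "(ripALM_residual A b f \<sigma> \<tau> y x y' + (\<tau> / \<sigma>) *\<^sub>R (y - y'), (1 / \<sigma>) *\<^sub>R (x - x'))
           \<in> lagrangian_subgrad A b f (y', x')"
proof -
  have "ripALM_residual A b f \<sigma> \<tau> y x y' + (\<tau> / \<sigma>) *\<^sub>R (y - y') = A *v x' - b"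
    by (simp only: ripALM_residual_def aug_lagrangian_gradient[OF assms(1,2)] x')
      (simp add: algebra_simps)
  moreover have "(1 / \<sigma>) *\<^sub>R (x + \<sigma> *\<^sub>R (transpose A *v y') - x') \<in> subdifferential f x'"
    unfolding x' by (rule prox_subgradient[OF assms(1,2)])
  moreover have "(1 / \<sigma>) *\<^sub>R (x + \<sigma> *\<^sub>R (transpose A *v y') - x') - transpose A *v y'
      = (1 / \<sigma>) *\<^sub>R (x - x')"
    using assms(2) by (simp add: algebra_simps del: transpose_matrix_vector)
  ultimately show ?thesis
    unfolding lagrangian_subgrad_def by (auto simp del: transpose_matrix_vector intro!: exI)
qed

lemma ripALM_imp_inexact_proximal_step:
  fixes A :: "real ^ 'n ^ 'm"
  assumes "proper_closed_convex f" and "\<rho> \<ge> 0" and "\<sigma> k > 0" and "\<tau> k > 0"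
    and alg: "ripALM A b f \<rho> \<sigma> \<tau> y x w"
  shows "inexact_proximal_step A b f (\<sigma> k) (\<tau> k) \<rho> (y k) (y (Suc k))
           (ripALM_residual A b f (\<sigma> k) (\<tau> k) (y k) (x k) (y (Suc k))) (x k) (x (Suc k))"
proof
  let ?\<Delta> = "ripALM_residual A b f (\<sigma> k) (\<tau> k) (y k) (x k) (y (Suc k))"
  show "proper_fun f" using assms(1) by (simp add: proper_closed_convex_def)
  have x_Suc: "x (Suc k) = prox (\<sigma> k) f (x k + \<sigma> k *\<^sub>R (transpose A *v y (Suc k)))"
    and criterion: "2 * \<bar>(w k - y (Suc k)) \<bullet> (\<sigma> k *\<^sub>R ?\<Delta>)\<bar> + (norm (\<sigma> k *\<^sub>R ?\<Delta>))\<^sup>2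
      \<le> \<rho> * ((norm (x (Suc k) - x k))\<^sup>2 + \<tau> k * (norm (y (Suc k) - y k))\<^sup>2)"
    using alg by (simp_all only: ripALM_def Let_def)
  show "(?\<Delta> + (\<tau> k / \<sigma> k) *\<^sub>R (y k - y (Suc k)), (1 / \<sigma> k) *\<^sub>R (x k - x (Suc k)))
      \<in> lagrangian_subgrad A b f (y (Suc k), x (Suc k))"
    using assms(1,3) x_Suc by (rule ripALM_inclusion)
  show "(norm (\<sigma> k *\<^sub>R ?\<Delta>))\<^sup>2
      \<le> \<rho> * ((norm (x (Suc k) - x k))\<^sup>2 + \<tau> k * (norm (y (Suc k) - y k))\<^sup>2)"
    using criterion by linarith
qed (use assms in auto)

section \<open>Scalar sequences\<close>

lemma bounded_by_growth_product:
  fixes t n :: "nat \<Rightarrow> real"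
  assumes "\<And>k. t (Suc k) \<le> (1 + n k) * t k" and "\<And>k. n k \<ge> 0" and "summable n" and "t 0 \<ge> 0"
  shows "t k \<le> t 0 * prodinf (\<lambda>k. 1 + n k)"
proof -
  have "t k \<le> t 0 * (\<Prod>i<k. 1 + n i)" for k
  proof (induction k)
    case (Suc k)
    have "t (Suc k) \<le> (1 + n k) * (t 0 * (\<Prod>i<k. 1 + n i))"
      using Suc assms(2)[of k] by (intro order_trans[OF assms(1)] mult_left_mono) auto
    then show ?case by (simp add: mult.commute mult.left_commute)
  qed simp
  moreover have "(\<Prod>i<k. 1 + n i) \<le> prodinf (\<lambda>k. 1 + n k)"
  proof (rule prod_le_prodinf)
    have "convergent_prod (\<lambda>k. 1 + n k)"
      using assms(2,3)
      by (intro abs_convergent_prod_imp_convergent_prod summable_imp_abs_convergent_prod) simp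
    then show "(\<lambda>k. 1 + n k) has_prod prodinf (\<lambda>k. 1 + n k)"
      by (simp add: convergent_prod_has_prod_iff)
  qed (use assms(2) in \<open>auto simp: add_nonneg_nonneg\<close>)
  ultimately show ?thesis
    using assms(4) by (meson mult_left_mono order_trans)
qed

lemma limsup_sqrt_ratio_less_1:
  fixes n g :: "nat \<Rightarrow> real"
  assumes "n \<longlonglongrightarrow> 0" and "\<And>k. n k \<ge> 0" and "g0 > 0" and "\<forall>\<^sub>F k in sequentially. g0 \<le> g k"
  shows "limsup (\<lambda>k. ereal (sqrt ((1 + n k) / (1 + g k)))) < 1"
proof -
  have "\<forall>\<^sub>F k in sequentially. ereal (sqrt ((1 + n k) / (1 + g k))) \<le> ereal (sqrt ((1 + n k) / (1 + g0)))"
    using assms(4)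
  proof eventually_elim
    case (elim k)
    then show ?case
      using assms(2)[of k] assms(3) by (auto intro!: divide_left_mono mult_pos_pos)
  qed
  then have "limsup (\<lambda>k. ereal (sqrt ((1 + n k) / (1 + g k))))
      \<le> limsup (\<lambda>k. ereal (sqrt ((1 + n k) / (1 + g0))))"
    by (rule Limsup_mono)
  also have "\<dots> = ereal (sqrt ((1 + 0) / (1 + g0)))"
    by (intro lim_imp_Limsup tendsto_intros assms(1)) (use assms(3) in auto)
  also have "\<dots> < 1" using assms(3) by simp
  finally show ?thesis .
qed

text \<open>
  The bounds \<open>d k\<close> decay geometrically, hence so do the increments of \<open>y\<close>, which are therefore
  summable.
\<close>

lemma convergent_of_contracting_increments:
  fixes y :: "nat \<Rightarrow> 'a::banach" and d m :: "nat \<Rightarrow> real"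
  assumes "limsup (\<lambda>k. ereal (m k)) < 1" and "\<And>k. d k \<ge> 0"
    and "\<forall>\<^sub>F k in sequentially. d (Suc k) \<le> m k * d k"
    and incr: "\<forall>\<^sub>F k in sequentially. norm (y (Suc k) - y k) \<le> C * d k"
  shows "convergent y"
proof -
  obtain q where q: "limsup (\<lambda>k. ereal (m k)) < ereal q" "ereal q < 1"
    using ereal_dense2[OF assms(1)] by auto
  have "\<forall>\<^sub>F k in sequentially. norm (d (Suc k)) \<le> q * norm (d k)"
    using Limsup_lessD[OF q(1)] assms(3)
  proof eventually_elim
    case (elim k)
    have "m k * d k \<le> q * d k" using elim(1) assms(2) by (intro mult_right_mono) auto
    with elim(2) show ?case using assms(2) by simp
  qed
  then have "summable d"
    using q(2) by (auto simp: eventually_sequentially intro!: summable_ratio_test[of q])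
  then have "summable (\<lambda>k. C * d k)" by (rule summable_mult)
  with incr have "summable (\<lambda>k. y (Suc k) - y k)" by (rule summable_comparison_test_ev)
  then have "(\<lambda>n. y n - y 0) \<longlonglongrightarrow> (\<Sum>k. y (Suc k) - y k)"
    using summable_LIMSEQ by (fastforce simp: sum_lessThan_telescope)
  then have "(\<lambda>n. (y n - y 0) + y 0) \<longlonglongrightarrow> (\<Sum>k. y (Suc k) - y k) + y 0"
    by (intro tendsto_add tendsto_const)
  then show ?thesis by (auto simp: convergent_def)
qed

section \<open>The asymptotic rate\<close>

theorem theorem3p2:
  fixes f :: "real ^ 'n \<Rightarrow> ereal"
    and A :: "real ^ 'n ^ 'm"
    and b :: "real ^ 'm"
    and \<rho> \<sigma>min \<tau>min r \<kappa> c :: real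
    and \<sigma> \<tau> \<nu> :: "nat \<Rightarrow> real"
    and y w :: "nat \<Rightarrow> real ^ 'm"
    and x :: "nat \<Rightarrow> real ^ 'n"
    and \<Omega> :: "((real ^ 'm) \<times> (real ^ 'n)) set"
    and \<tau>max \<tau>bmax :: real
    and \<tau>b \<gamma> \<mu> :: "nat \<Rightarrow> real"
    and \<Lambda> :: "nat \<Rightarrow> (real ^ 'm) \<times> (real ^ 'n) \<Rightarrow> (real ^ 'm) \<times> (real ^ 'n)"
  defines "\<Omega> \<equiv> saddle_points A b f"
    and "\<tau>max \<equiv> \<tau> 0 * prodinf (\<lambda>k. 1 + \<nu> k)"
    and "\<tau>bmax \<equiv> max 1 \<tau>max"
    and "\<tau>b \<equiv> \<lambda>k. max 1 (\<tau> k)"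
    and "\<Lambda> \<equiv> \<lambda>k. diag_op (\<tau> k)"
    and "\<gamma> \<equiv> \<lambda>k. (1 - (2 * \<kappa> * sqrt (\<tau> k) * (\<rho> + sqrt (\<rho> * \<tau>b k)) + 2 * \<sigma> k * sqrt \<rho>)
                        / (\<sigma> k * sqrt (\<tau> k)))
                  * ((\<sigma> k)\<^sup>2 / (\<kappa>\<^sup>2 * (sqrt \<rho> + sqrt (\<tau>b k))\<^sup>2 * \<tau>b k))"
    and "\<mu> \<equiv> \<lambda>k. sqrt ((1 + \<nu> k) / (1 + \<gamma> k))"
  assumes "proper_closed_convex f"
    and "0 \<le> \<rho>" and "\<rho> < 1"
    and "\<sigma>min > 0" and "\<And>k. \<sigma> k \<ge> \<sigma>min"
    and "\<tau>min > 0" and "\<And>k. \<tau> k \<ge> \<tau>min"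
    and "\<And>k. \<tau> (Suc k) \<le> (1 + \<nu> k) * \<tau> k"
    and "\<And>k. \<nu> k \<ge> 0" and "summable \<nu>"
    and "ripALM A b f \<rho> \<sigma> \<tau> y x w"
    and "\<Omega> \<noteq> {}"
    and "\<And>r'. r' > 0 \<Longrightarrow> \<exists>\<kappa>'>0. error_bound A b f r' \<kappa>'"
    and "r > 0" and "\<And>k. dist_to (y k, x k) \<Omega> \<le> ereal r"
    and "\<kappa> > 0" and "error_bound A b f r \<kappa>"
    and "c > 1"
    and "sqrt \<tau>min - 2 * sqrt \<rho> > 0"
    and "liminf (\<lambda>k. ereal (\<sigma> k)) >
           ereal (c * (2 * \<kappa> * sqrt \<tau>max * (\<rho> + sqrt (\<rho> * \<tau>bmax)) / (sqrt \<tau>min - 2 * sqrt \<rho>)))"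
  shows "(\<forall>\<^sub>F k in sequentially.
            \<gamma> k \<ge> (c - 1) / c * ((sqrt \<tau>min - 2 * sqrt \<rho>) / sqrt \<tau>min)
                    * ((\<sigma> k)\<^sup>2 / (\<kappa>\<^sup>2 * (sqrt \<rho> + sqrt \<tau>bmax)\<^sup>2 * \<tau>bmax))
            \<and> (c - 1) / c * ((sqrt \<tau>min - 2 * sqrt \<rho>) / sqrt \<tau>min)
                    * ((\<sigma> k)\<^sup>2 / (\<kappa>\<^sup>2 * (sqrt \<rho> + sqrt \<tau>bmax)\<^sup>2 * \<tau>bmax)) > 0
            \<and> wdist_to (\<Lambda> (Suc k)) (y (Suc k), x (Suc k)) \<Omega>
                \<le> ereal (\<mu> k) * wdist_to (\<Lambda> k) (y k, x k) \<Omega>)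
         \<and> limsup (\<lambda>k. ereal (\<mu> k)) < 1
         \<and> convergent y"
proof -
  note pcc = assms(8)
    and rho_nonneg = assms(9)
    and sigma_min = assms(11)
    and sigma_ge = assms(12)
    and tau_min = assms(13)
    and tau_ge = assms(14)
    and tau_growth = assms(15)
    and nu_nonneg = assms(16)
    and nu_summable = assms(17)
    and algorithm = assms(18)
    and saddle_exists = assms(19)
    and near_saddle = assms(22)
    and kappa = assms(23)
    and eb = assms(24)
    and c_gt_1 = assms(25)
    and gap = assms(26)
    and liminf = assms(27)
  define \<theta> where "\<theta> = (c - 1) / c * ((sqrt \<tau>min - 2 * sqrt \<rho>) / sqrt \<tau>min)"
  define K where "K = \<kappa>\<^sup>2 * (sqrt \<rho> + sqrt \<tau>bmax)\<^sup>2 * \<tau>bmax"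
  define d where "d = (\<lambda>k. weighted_dist (\<tau> k) (y k, x k) \<Omega>)"
  have sigma_pos: "\<sigma> k > 0" and tau_pos: "\<tau> k > 0" for k
    using sigma_min sigma_ge tau_min tau_ge by (meson less_le_trans)+
  have \<theta>: "\<theta> > 0" using tau_min c_gt_1 gap by (simp add: \<theta>_def)
  have "sqrt \<rho> + sqrt \<tau>bmax > 0"
    using rho_nonneg by (auto simp: \<tau>bmax_def intro!: add_nonneg_pos)
  then have K: "K > 0" using kappa by (simp add: K_def \<tau>bmax_def)
  have d_nonneg: "d k \<ge> 0" for k
    unfolding d_def using tau_pos saddle_exists by (intro weighted_dist_nonneg) (auto simp: less_imp_le)
  have \<tau>_le: "\<tau> k \<le> \<tau>max" for k
    unfolding \<tau>max_def using tau_growth nu_nonneg nu_summable tau_pos[of 0] by (intro bounded_by_growth_product) auto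
  \<comment> \<open>the last estimate combines \<open>sqrt \<theta> * D \<le> d k\<close> with \<open>sqrt \<tau>min * norm (y (Suc k) - y k) \<le> D\<close>\<close>
  have step: "\<theta> * ((\<sigma> k)\<^sup>2 / K) \<le> \<gamma> k \<and> d (Suc k) \<le> \<mu> k * d k
      \<and> norm (y (Suc k) - y k) \<le> 1 / (sqrt \<theta> * sqrt \<tau>min) * d k"
    if large: "c * (2 * \<kappa> * sqrt \<tau>max * (\<rho> + sqrt (\<rho> * \<tau>bmax)) / (sqrt \<tau>min - 2 * sqrt \<rho>)) < \<sigma> k" for k
  proof -
    interpret inexact_proximal_step_error_bound A b f "\<sigma> k" "\<tau> k" \<rho> "y k" "y (Suc k)"
      "ripALM_residual A b f (\<sigma> k) (\<tau> k) (y k) (x k) (y (Suc k))" "x k" "x (Suc k)" \<kappa> r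
      by (intro inexact_proximal_step_error_bound.intro inexact_proximal_step_error_bound_axioms.intro
          ripALM_imp_inexact_proximal_step[where w = w])
        (use pcc rho_nonneg algorithm saddle_exists near_saddle kappa eb sigma_pos tau_pos in \<open>auto simp: \<Omega>_def\<close>)
    have \<theta>_le: "\<theta> \<le> decrease_factor"
      unfolding \<theta>_def using tau_min tau_ge c_gt_1 gap \<tau>_le large unfolding \<tau>bmax_def
      by (intro decrease_factor_lower_bound) auto
    have \<gamma>_eq: "\<gamma> k = decrease_factor / (error_modulus\<^sup>2 * max 1 (\<tau> k))"
      unfolding \<gamma>_def \<tau>b_def decrease_factor_eq inverse_error_modulus_eq by simp
    have "(\<sigma> k)\<^sup>2 / K \<le> (\<sigma> k)\<^sup>2 / (\<kappa>\<^sup>2 * (sqrt \<rho> + sqrt (max 1 (\<tau> k)))\<^sup>2 * max 1 (\<tau> k))"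
      (is "_ \<le> _ / ?k")
    proof (rule divide_left_mono)
      show "?k \<le> K"
        unfolding K_def \<tau>bmax_def using \<tau>_le[of k] \<rho>_nonneg \<kappa>_pos
        by (intro mult_mono power_mono add_mono) (auto simp: add_nonneg_nonneg)
      have "sqrt \<rho> + sqrt (max 1 (\<tau> k)) > 0" using \<rho>_nonneg by (intro add_nonneg_pos) auto
      then show "0 < K * ?k" using K \<kappa>_pos by simp
    qed simp
    also have "\<dots> = 1 / (error_modulus\<^sup>2 * max 1 (\<tau> k))" by (rule inverse_error_modulus_eq)
    finally have "\<theta> * ((\<sigma> k)\<^sup>2 / K) \<le> decrease_factor * (1 / (error_modulus\<^sup>2 * max 1 (\<tau> k)))"
      using \<theta>_le \<theta> K by (intro mult_mono) auto
    then have \<gamma>_ge: "\<theta> * ((\<sigma> k)\<^sup>2 / K) \<le> \<gamma> k" by (simp add: \<gamma>_eq)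
    then have \<gamma>_pos: "\<gamma> k \<ge> 0"
      by (rule order_trans[rotated]) (use \<theta> K in simp)
    have \<theta>_nonneg: "decrease_factor \<ge> 0" using \<theta> \<theta>_le by simp
    have "d (Suc k) \<le> sqrt (1 + \<nu> k) * weighted_dist (\<tau> k) (y (Suc k), x (Suc k)) \<Omega>"
      unfolding d_def using tau_growth nu_nonneg saddle_exists
      by (intro weighted_dist_reweight less_imp_le[OF tau_pos]) auto
    also have "weighted_dist (\<tau> k) (y (Suc k), x (Suc k)) \<Omega> \<le> d k / sqrt (1 + \<gamma> k)"
      using contraction[OF \<theta>_nonneg] \<gamma>_pos
      by (simp add: d_def \<Omega>_def \<gamma>_eq pos_le_divide_eq mult.commute)
    then have "sqrt (1 + \<nu> k) * weighted_dist (\<tau> k) (y (Suc k), x (Suc k)) \<Omega>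
        \<le> sqrt (1 + \<nu> k) * (d k / sqrt (1 + \<gamma> k))"
      using nu_nonneg[of k] by (intro mult_left_mono) auto
    also have "\<dots> = \<mu> k * d k"
      by (simp add: \<mu>_def real_sqrt_divide)
    finally have contr: "d (Suc k) \<le> \<mu> k * d k" .
    have "sqrt \<theta> * (sqrt \<tau>min * norm (y (Suc k) - y k)) \<le> sqrt decrease_factor * step_length"
    proof (rule mult_mono)
      have "sqrt \<tau>min * norm (y (Suc k) - y k) \<le> sqrt (\<tau> k) * norm (y (Suc k) - y k)"
        using tau_ge by (intro mult_right_mono) auto
      also have "\<dots> \<le> step_length"
        using dual_step_le tau_pos[of k] by (simp add: pos_le_divide_eq mult.commute)
      finally show "sqrt \<tau>min * norm (y (Suc k) - y k) \<le> step_length" .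
    qed (use \<theta> \<theta>_le tau_min in auto)
    also have "\<dots> \<le> d k"
      unfolding d_def \<Omega>_def by (rule step_length_le_dist[OF \<theta>_nonneg])
    finally have "norm (y (Suc k) - y k) \<le> 1 / (sqrt \<theta> * sqrt \<tau>min) * d k"
      using \<theta> tau_min by (simp add: pos_le_divide_eq mult.commute mult.left_commute)
    with \<gamma>_ge contr show ?thesis by blast
  qed
  have large: "\<forall>\<^sub>F k in sequentially.
      c * (2 * \<kappa> * sqrt \<tau>max * (\<rho> + sqrt (\<rho> * \<tau>bmax)) / (sqrt \<tau>min - 2 * sqrt \<rho>)) < \<sigma> k"
    using less_LiminfD[OF liminf] by simp
  have limsup: "limsup (\<lambda>k. ereal (\<mu> k)) < 1"
    unfolding \<mu>_def
  proof (rule limsup_sqrt_ratio_less_1)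
    show "\<nu> \<longlonglongrightarrow> 0" using nu_summable by (rule summable_LIMSEQ_zero)
    \<comment> \<open>a bound on \<open>\<gamma>\<close> that no longer depends on the iteration\<close>
    show "0 < \<theta> * (\<sigma>min\<^sup>2 / K)" using \<theta> K sigma_min by simp
    show "\<forall>\<^sub>F k in sequentially. \<theta> * (\<sigma>min\<^sup>2 / K) \<le> \<gamma> k"
      using large
    proof eventually_elim
      case (elim k)
      have "\<theta> * (\<sigma>min\<^sup>2 / K) \<le> \<theta> * ((\<sigma> k)\<^sup>2 / K)"
        using \<theta> K sigma_min sigma_ge by (intro mult_left_mono divide_right_mono power_mono) auto
      then show ?case using step[OF elim] by linarith
    qed
  qed (rule nu_nonneg)
  moreover have "convergent y"
  proof (rule convergent_of_contracting_increments[where d = d, OF limsup d_nonneg])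
    show "\<forall>\<^sub>F k in sequentially. d (Suc k) \<le> \<mu> k * d k"
      using large by eventually_elim (use step in blast)
    show "\<forall>\<^sub>F k in sequentially. norm (y (Suc k) - y k) \<le> 1 / (sqrt \<theta> * sqrt \<tau>min) * d k"
      using large by eventually_elim (use step in blast)
  qed
  moreover have "wdist_to (\<Lambda> k) (y k, x k) \<Omega> = ereal (d k)" for k
    unfolding \<Lambda>_def d_def using tau_pos saddle_exists by (intro wdist_to_eq) (auto simp: less_imp_le)
  moreover have "0 < \<theta> * ((\<sigma> k)\<^sup>2 / K)" for k
    using \<theta> K sigma_pos by (intro mult_pos_pos divide_pos_pos zero_less_power)
  ultimately show ?thesis
    unfolding \<theta>_def[symmetric] K_def[symmetric]
    using step by (auto intro: eventually_mono[OF large])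
qed

end
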